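(* For any infinite field $F$ of characteristic $p>2$ and any $n\ge 4$, the monoid $U^{\pm}T_n(F)$ is inherently nonfinitely based.
   Context: An $n\times n$ matrix $(\alpha_{ij})$ is triangular if $\alpha_{ij}=0$ whenever $j<i$. For a field $F$ of characteristic different from $2$, $U^{\pm}T_n(F)$ is the monoid, under matrix multiplication, of all triangular $n\times n$ matrices over $F$ whose diagonal entries all lie in $\{0,1,-1\}$. Monoids are considered as semigroups, i.e., in the signature with only the binary multiplication. Let $\mathcal{X}^+$ be the free semigroup on a countably infinite set $\mathcal{X}$ of variables. A semigroup identity is a pair $\mathbf{u}\approx\mathbf{v}$ of words in $\mathcal{X}^+$; it holds in a semigroup $S$ if $\varphi(\mathbf{u})=\varphi(\mathbf{v})$ for every morphism $\varphi:\mathcal{X}^+\to S$. A variety is the class of all semigroups satisfying a given set of identities; it is finitely based if it can be defined by a finite set of identities. The variety $\mathsf{var}\,S$ generated by $S$ is the class of all semigroups satisfying all identities of $S$. A variety is locally finite if all its finitely generated members are finite. A locally finite variety is inherently nonfinitely based if it is not contained in any finitely based, locally finite variety; a semigroup $S$ is inherently nonfinitely based if $\mathsf{var}\,S$ is (in particular, $\mathsf{var}\,S$ is locally finite). *)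

theory Defs
  imports "Jordan_Normal_Form.Matrix"
begin

section \<open>Semigroups\<close>

record 'a sgrp = "'a partial_object" +
  sgmult :: "'a \<Rightarrow> 'a \<Rightarrow> 'a" (infixl \<open>\<cdot>\<index>\<close> 70)

definition is_semigroup :: "'a sgrp \<Rightarrow> bool" where
  "is_semigroup S \<longleftrightarrow>
     carrier S \<noteq> {} \<and>
     (\<forall>x\<in>carrier S. \<forall>y\<in>carrier S. x \<cdot>\<^bsub>S\<^esub> y \<in> carrier S) \<and>
     (\<forall>x\<in>carrier S. \<forall>y\<in>carrier S. \<forall>z\<in>carrier S.
        (x \<cdot>\<^bsub>S\<^esub> y) \<cdot>\<^bsub>S\<^esub> z = x \<cdot>\<^bsub>S\<^esub> (y \<cdot>\<^bsub>S\<^esub> z))"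

definition semigroup_morphism :: "'a sgrp \<Rightarrow> 'b sgrp \<Rightarrow> ('a \<Rightarrow> 'b) \<Rightarrow> bool" where
  "semigroup_morphism S T \<phi> \<longleftrightarrow>
     (\<forall>x\<in>carrier S. \<phi> x \<in> carrier T) \<and>
     (\<forall>x\<in>carrier S. \<forall>y\<in>carrier S. \<phi> (x \<cdot>\<^bsub>S\<^esub> y) = \<phi> x \<cdot>\<^bsub>T\<^esub> \<phi> y)"

inductive_set generated_subsemigroup :: "'a sgrp \<Rightarrow> 'a set \<Rightarrow> 'a set"
  for S :: "'a sgrp" and X :: "'a set" where
  gen: "x \<in> X \<Longrightarrow> x \<in> generated_subsemigroup S X"
| mult: "x \<in> generated_subsemigroup S X \<Longrightarrow> y \<in> generated_subsemigroup S X \<Longrightarrow>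
         x \<cdot>\<^bsub>S\<^esub> y \<in> generated_subsemigroup S X"

definition finitely_generated :: "'a sgrp \<Rightarrow> bool" where
  "finitely_generated S \<longleftrightarrow>
     (\<exists>X. finite X \<and> X \<subseteq> carrier S \<and> generated_subsemigroup S X = carrier S)"


section \<open>Identities\<close>

text \<open>The countably infinite set of variables is \<^typ>\<open>nat\<close>; the elements of the free semigroup
  on it are the nonempty lists of variables.\<close>

type_synonym word = "nat list"
type_synonym identity = "word \<times> word"

definition free_semigroup :: "word sgrp" where
  "free_semigroup = \<lparr>carrier = {w. w \<noteq> []}, sgmult = (@)\<rparr>"

definition identities :: "identity set" where
  "identities = carrier free_semigroup \<times> carrier free_semigroup"

definition holds_in :: "identity \<Rightarrow> 'a sgrp \<Rightarrow> bool" where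
  "holds_in e S \<longleftrightarrow>
     (\<forall>\<phi>. semigroup_morphism free_semigroup S \<phi> \<longrightarrow> \<phi> (fst e) = \<phi> (snd e))"


section \<open>Varieties\<close>

text \<open>HOL has no collection of all semigroups, so classes of semigroups are taken relative to a type
  \<open>'u\<close> used as a universe: ``all semigroups'' are all those carried by some subset of \<open>'u\<close>.
  Statements about varieties are meant to be made for every infinite type \<open>'u\<close>, so that \<open>'u\<close> may
  be chosen arbitrarily large.\<close>

definition models :: "identity set \<Rightarrow> 'u sgrp set" where
  "models \<Sigma> = {T. is_semigroup T \<and> (\<forall>e\<in>\<Sigma>. holds_in e T)}"

definition variety :: "'u sgrp set \<Rightarrow> bool" where
  "variety V \<longleftrightarrow> (\<exists>\<Sigma>. \<Sigma> \<subseteq> identities \<and> V = models \<Sigma>)"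

definition finitely_based :: "'u sgrp set \<Rightarrow> bool" where
  "finitely_based V \<longleftrightarrow> (\<exists>\<Sigma>. \<Sigma> \<subseteq> identities \<and> finite \<Sigma> \<and> V = models \<Sigma>)"

definition locally_finite :: "'u sgrp set \<Rightarrow> bool" where
  "locally_finite V \<longleftrightarrow> (\<forall>T\<in>V. finitely_generated T \<longrightarrow> finite (carrier T))"

definition inherently_nonfinitely_based_variety :: "'u sgrp set \<Rightarrow> bool" where
  "inherently_nonfinitely_based_variety V \<longleftrightarrow>
     variety V \<and> locally_finite V \<and>
     \<not> (\<exists>W. variety W \<and> finitely_based W \<and> locally_finite W \<and> V \<subseteq> W)"

text \<open>The semigroup \<open>S\<close> itself need not be carried by the universe \<open>'u\<close>: the variety it generates
  is determined by the identities of \<open>S\<close>.\<close>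

definition generated_variety :: "'a sgrp \<Rightarrow> 'u sgrp set" where
  "generated_variety S = models {e \<in> identities. holds_in e S}"

definition inherently_nonfinitely_based :: "'u itself \<Rightarrow> 'a sgrp \<Rightarrow> bool" where
  "inherently_nonfinitely_based U S \<longleftrightarrow>
     inherently_nonfinitely_based_variety (generated_variety S :: 'u sgrp set)"


section \<open>Triangular matrices with diagonal entries in \<open>{0, 1, -1}\<close>\<close>

definition UT_pm :: "nat \<Rightarrow> 'f::field mat sgrp" where
  "UT_pm n =
     \<lparr>carrier = {A \<in> carrier_mat n n. upper_triangular A \<and> (\<forall>i<n. A $$ (i, i) \<in> {0, 1, -1})},
      sgmult = (*)\<rparr>"

lemma UT_pm_mult_diag:
  fixes A B :: "'f::field mat"
  assumes "A \<in> carrier_mat n n" "B \<in> carrier_mat n n"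
    and "upper_triangular A" "upper_triangular B" and "j \<le> i" "i < n"
  shows "(A * B) $$ (i, j) = (if i = j then A $$ (i, i) * B $$ (i, i) else 0)"
proof -
  have z: "A $$ (i, k) * B $$ (k, j) = 0" if "k < n" "\<not> (k = i \<and> i = j)" for k
  proof (cases "k < i")
    case True
    then show ?thesis using assms by (simp add: upper_triangular_def)
  next
    case False
    with that assms have "j < k" by linarith
    then show ?thesis using assms that by (simp add: upper_triangular_def)
  qed
  have "(A * B) $$ (i, j) = (\<Sum>k = 0..<n. A $$ (i, k) * B $$ (k, j))"
    using assms by (simp add: scalar_prod_def)
  also have "\<dots> = (\<Sum>k = 0..<n. if k = i then (if i = j then A $$ (i, i) * B $$ (i, i) else 0) else 0)"
    using z by (intro sum.cong) auto
  finally show ?thesis using assms by simp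
qed

lemma is_semigroup_UT_pm: "is_semigroup (UT_pm n :: 'f::field mat sgrp)"
proof -
  have "1\<^sub>m n \<in> carrier (UT_pm n :: 'f mat sgrp)"
    by (simp add: UT_pm_def)
  moreover have "A * B \<in> carrier (UT_pm n)"
    if "A \<in> carrier (UT_pm n)" "B \<in> carrier (UT_pm n)" for A B :: "'f mat"
  proof -
    have c: "A \<in> carrier_mat n n" "B \<in> carrier_mat n n" "upper_triangular A" "upper_triangular B"
      and d: "\<And>i. i < n \<Longrightarrow> A $$ (i, i) \<in> {0, 1, -1}" "\<And>i. i < n \<Longrightarrow> B $$ (i, i) \<in> {0, 1, -1}"
      using that by (auto simp: UT_pm_def)
    have m: "A * B \<in> carrier_mat n n" using c by simp
    have "upper_triangular (A * B)"
      proof (rule upper_triangularI)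
      fix i j assume "j < i" "i < dim_row (A * B)"
      then show "(A * B) $$ (i, j) = 0"
        using UT_pm_mult_diag[OF c, of j i] m carrier_matD(1)[OF m] by (simp del: index_mult_mat(1))
    qed
    moreover have "(A * B) $$ (i, i) \<in> {0, 1, -1}" if "i < n" for i
      using d(1)[OF that] d(2)[OF that]
      by (subst UT_pm_mult_diag[OF c order_refl that]) auto
    ultimately show ?thesis using m by (simp add: UT_pm_def del: index_mult_mat(1))
  qed
  moreover have "(A * B) * C = A * (B * C)"
    if "A \<in> carrier (UT_pm n)" "B \<in> carrier (UT_pm n)" "C \<in> carrier (UT_pm n)" for A B C :: "'f mat"
    using that by (intro assoc_mult_mat) (auto simp: UT_pm_def)
  moreover have "sgmult (UT_pm n) = ((*) :: 'f mat \<Rightarrow> _)"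
    by (simp add: UT_pm_def)
  ultimately show ?thesis
    unfolding is_semigroup_def by (metis empty_iff)
qed

end

theory Submission
  imports Defs "HOL-Library.Sublist" "HOL-Library.Countable_Set"
begin

text \<open>Two facts are combined. First, the entries of a product of triangular matrices are sums over
  chains of off-diagonal entries, weighted by products of diagonal entries \<open>0\<close>, \<open>1\<close>, \<open>-1\<close>; in positive
  characteristic only finitely many such sums exist for a given finite set of letters, uniformly in the
  matrices, so the variety is locally finite.

  Second, every Zimin word is an isoterm. The word \<open>Z\<^bsub>k+1\<^esub>\<close> arises from \<open>Z\<^bsub>k\<^esub>\<close> by putting a new letter
  into each gap. A suitable \<open>4 \<times> 4\<close> matrix for the new letter detects whether a gap contains it exactly
  once, while sign matrices for the remaining letters weight the gaps by characters that are linearly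
  independent, because \<open>Z\<^bsub>k\<^esub>\<close> is a Gray code and the characteristic is not two.

  By an argument of Sapir, based on the theory of avoidable words of Bean, Ehrenfeucht, McNulty and
  Zimin, this excludes any finitely based locally finite overvariety: if all Zimin words are isoterms for
  identities in at most \<open>n\<close> letters, then so are the iterates of a substitution over a fixed finite alphabet,
  and the Rees quotient by the non-factors of these iterates is an infinite finitely generated model.\<close>

section \<open>Encounters with Zimin words, and deletion of letters\<close>

section \<open>Zimin words and fusions\<close>

text \<open>All that Zimin isoterms reveal about an identity is the relation \<open>rigid\<close>,
  and it is vacuous when \<open>fits\<close> fails. The induction along the iterated substitution
  therefore has to prove \<open>fits\<close> together with the equality of values. The bound on the
  number of letters enters by pigeonhole: when blocks have more columns than there are letters, some
  adjacent columns \<open>k\<close> and \<open>k + 1\<close> are never separated by the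
  factorization. Letters of a block carry its two indices alternately, so this pair identifies the
  block, and the factorization can be pulled back one level. The obstacle is that letters missing
  the pair vanish there, although rigidity is not obviously inherited when letters are erased.
  Fusions resolve this in both directions: read cyclically from the column after the pair, every
  erased piece is an upward step, which makes the erasure legitimate; and since fusions pass from
  \<open>u\<close> to \<open>v\<close>, the erased columns are recovered in \<open>v\<close> one at
  a time. Size four comes from the detector of a single occurrence: one coordinate carries the sign,
  two delay it, one accumulates.\<close>

abbreviation subst :: "('a \<Rightarrow> 'b list) \<Rightarrow> 'a list \<Rightarrow> 'b list" where
  "subst \<phi> u \<equiv> concat (map \<phi> u)"

abbreviation nonerasing :: "('a \<Rightarrow> 'b list) \<Rightarrow> bool" where
  "nonerasing \<phi> \<equiv> \<forall>x. \<phi> x \<noteq> []"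

definition pad :: "nat list \<Rightarrow> nat list" where
  "pad w = subst (\<lambda>z. [Suc z, 0]) w"

text \<open>The usual recursion is \<open>zimin_middle\<close>. Inserting the new letter into the
  gaps instead makes one step invertible by \<open>unpad\<close>, which suits both the lifting of
  substitutions and the matrix argument.\<close>

fun zimin :: "nat \<Rightarrow> nat list" where
  "zimin 0 = []"
| "zimin (Suc k) = 0 # pad (zimin k)"

lemma pad_simps [simp]: "pad [] = []" "pad (x # w) = Suc x # 0 # pad w" "pad (v @ w) = pad v @ pad w"
  by (simp_all add: pad_def)

lemma zimin_middle: "zimin (Suc k) = zimin k @ [k] @ zimin k"
  by (induction k) auto

lemma set_zimin: "set (zimin k) = {..<k}"
proof (induction k)
  case (Suc k)
  then show ?case
    by (simp only: zimin_middle set_append list.set) (simp add: lessThan_Suc)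
qed simp

text \<open>By the theorem of Bean, Ehrenfeucht, McNulty and Zimin, these are the unavoidable
  words.\<close>

definition fits :: "'a list \<Rightarrow> bool" where
  "fits u \<longleftrightarrow> (\<exists>k \<phi>. nonerasing \<phi> \<and> sublist (subst \<phi> u) (zimin k))"

text \<open>What remains of an identity of a semigroup for which Zimin words are isoterms. Later
  arguments use only this relation, because it survives deletions for which no identity of the
  semigroup is at hand.\<close>

definition rigid :: "'a list \<Rightarrow> 'a list \<Rightarrow> bool" where
  "rigid u v \<longleftrightarrow> (\<forall>k \<phi>. nonerasing \<phi> \<longrightarrow> sublist (subst \<phi> u) (zimin k) \<longrightarrow> subst \<phi> u = subst \<phi> v)"

lemma rigidD: "rigid u v \<Longrightarrow> nonerasing \<phi> \<Longrightarrow> sublist (subst \<phi> u) (zimin k) \<Longrightarrow> subst \<phi> u = subst \<phi> v"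
  by (simp add: rigid_def)

lemma fitsI: "nonerasing \<phi> \<Longrightarrow> sublist (subst \<phi> u) (zimin k) \<Longrightarrow> fits u"
  by (auto simp: fits_def)

lemma concat_map_subst: "subst \<phi> (subst \<sigma> u) = subst (\<lambda>x. subst \<phi> (\<sigma> x)) u"
  by (induction u) auto

lemma subst_neq_Nil: "(nonerasing \<phi>) \<Longrightarrow> u \<noteq> [] \<Longrightarrow> subst \<phi> u \<noteq> []"
  by (cases u) auto

lemma fits_subst:
  assumes "nonerasing \<sigma>" "fits (subst \<sigma> u)"
  shows "fits u"
proof -
  obtain k \<phi> where \<phi>: "nonerasing \<phi>" "sublist (subst \<phi> (subst \<sigma> u)) (zimin k)"
    using assms(2) unfolding fits_def by blast
  have "nonerasing (\<lambda>x. subst \<phi> (\<sigma> x))"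
    using subst_neq_Nil[OF \<phi>(1)] assms(1) by simp
  then show ?thesis
    using \<phi>(2) unfolding concat_map_subst by (rule fitsI)
qed

lemma rigid_subst:
  assumes "nonerasing \<sigma>" "rigid u v"
  shows "rigid (subst \<sigma> u) (subst \<sigma> v)"
  unfolding rigid_def
proof (intro allI impI)
  fix k \<phi> assume \<phi>: "nonerasing \<phi>" "sublist (subst \<phi> (subst \<sigma> u)) (zimin k)"
  have "nonerasing (\<lambda>x. subst \<phi> (\<sigma> x))"
    using subst_neq_Nil[OF \<phi>(1)] assms(1) by simp
  then show "subst \<phi> (subst \<sigma> u) = subst \<phi> (subst \<sigma> v)"
    using \<phi>(2) unfolding concat_map_subst by (rule rigidD[OF assms(2)])
qed

lemma sublist_subst: "sublist v u \<Longrightarrow> sublist (subst \<phi> v) (subst \<phi> u)"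
  unfolding sublist_def by (elim exE) (simp, intro exI, rule refl)

lemma fits_sublist:
  assumes "fits u" "sublist v u"
  shows "fits v"
proof -
  obtain k \<phi> where \<phi>: "nonerasing \<phi>" "sublist (subst \<phi> u) (zimin k)"
    using assms(1) unfolding fits_def by blast
  show ?thesis
    by (rule fitsI[OF \<phi>(1) sublist_order.order_trans[OF sublist_subst[OF assms(2)] \<phi>(2)]])
qed

lemma rigid_context:
  assumes "rigid u v" shows "rigid (a @ u @ b) (a @ v @ b)"
  unfolding rigid_def
proof (intro allI impI)
  fix k and \<phi> :: "'a \<Rightarrow> nat list" assume \<phi>: "nonerasing \<phi>" "sublist (subst \<phi> (a @ u @ b)) (zimin k)"
  have "sublist (subst \<phi> u) (zimin k)"
    by (rule sublist_order.order_trans[OF sublist_subst \<phi>(2)]) (rule sublist_appendI)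
  from rigidD[OF assms \<phi>(1) this] show "subst \<phi> (a @ u @ b) = subst \<phi> (a @ v @ b)"
    by simp
qed

text \<open>Two levels up there is a copy of \<open>zimin k\<close> flanked by the letters
  \<open>k\<close> and \<open>k + 1\<close>, so there is room on both sides even if \<open>w\<close>
  is a prefix or a suffix.\<close>

lemma sublist_zimin_context:
  assumes "sublist w (zimin k)"
  obtains a b where "a \<noteq> []" "b \<noteq> []" "sublist (a @ w @ b) (zimin (Suc (Suc k)))"
proof -
  obtain s t where "zimin k = s @ w @ t"
    using assms by (auto simp: sublist_def)
  then have "zimin (Suc (Suc k)) = (zimin k) @ ((k # s) @ w @ (t @ [Suc k])) @ (zimin k @ [k] @ zimin k)"
    by (simp add: zimin_middle del: zimin.simps(2))
  then have "sublist ((k # s) @ w @ (t @ [Suc k])) (zimin (Suc (Suc k)))"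
    by (metis sublist_appendI)
  then show thesis
    by (intro that[of "k # s" "t @ [Suc k]"]) auto
qed

lemma subst_cong: "(\<And>x. x \<in> set u \<Longrightarrow> \<phi> x = \<psi> x) \<Longrightarrow> subst \<phi> u = subst \<psi> u"
  by (metis map_eq_conv)

lemma fits_brackets:
  assumes "fits u" "p \<noteq> q" "p \<notin> set u" "q \<notin> set u"
  shows "fits (p # u @ [q])"
proof -
  obtain k \<phi> where \<phi>: "nonerasing \<phi>" "sublist (subst \<phi> u) (zimin k)"
    using assms(1) by (auto simp: fits_def)
  obtain a b where ab: "a \<noteq> []" "b \<noteq> []" "sublist (a @ subst \<phi> u @ b) (zimin (Suc (Suc k)))"
    using sublist_zimin_context[OF \<phi>(2)] by blast
  have "subst (\<phi>(p := a, q := b)) u = subst \<phi> u"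
    using assms by (intro subst_cong) auto
  then show ?thesis
    using ab \<phi>(1) assms(2) unfolding fits_def
    by (intro exI[of _ "Suc (Suc k)"] exI[of _ "\<phi>(p := a, q := b)"]) (simp del: zimin.simps)
qed

lemma rigid_brackets:
  assumes "rigid (p # u @ [q]) (p # v @ [q])" "p \<noteq> q" "p \<notin> set u \<union> set v" "q \<notin> set u \<union> set v"
  shows "rigid u v"
  unfolding rigid_def
proof (intro allI impI)
  fix k \<phi> assume \<phi>: "nonerasing \<phi>" "sublist (subst \<phi> u) (zimin k)"
  obtain a b where ab: "a \<noteq> []" "b \<noteq> []" "sublist (a @ subst \<phi> u @ b) (zimin (Suc (Suc k)))"
    using sublist_zimin_context[OF \<phi>(2)] by blast
  let ?\<psi> = "\<phi>(p := a, q := b)"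
  have e: "subst ?\<psi> u = subst \<phi> u" "subst ?\<psi> v = subst \<phi> v"
    using assms by (auto intro!: subst_cong)
  have "sublist (subst ?\<psi> (p # u @ [q])) (zimin (Suc (Suc k)))" "nonerasing ?\<psi>"
    using ab \<phi>(1) assms(2) e by (simp_all del: zimin.simps)
  then have "subst ?\<psi> (p # u @ [q]) = subst ?\<psi> (p # v @ [q])"
    using rigidD[OF assms(1)] by metis
  then show "subst \<phi> u = subst \<phi> v"
    using e assms(2) by simp
qed

text \<open>A letter of \<open>v\<close> missing from \<open>u\<close> could be sent to the letter
  \<open>k\<close>, which \<open>zimin k\<close> does not contain.\<close>

lemma rigid_set_subset:
  assumes "fits u" "rigid u v"
  shows "set v \<subseteq> set u"
proof
  fix z assume z: "z \<in> set v"
  obtain k \<phi> where \<phi>: "nonerasing \<phi>" "sublist (subst \<phi> u) (zimin k)"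
    using assms(1) by (auto simp: fits_def)
  show "z \<in> set u"
  proof (rule ccontr)
    assume zu: "z \<notin> set u"
    have e: "subst (\<phi>(z := [k])) u = subst \<phi> u"
      using zu by (intro subst_cong) auto
    then have "subst (\<phi>(z := [k])) u = subst (\<phi>(z := [k])) v"
      using assms(2) \<phi> unfolding rigid_def by simp
    then have "k \<in> set (subst \<phi> u)"
      using z e by force
    then have "k \<in> set (zimin k)"
      using \<phi>(2) by (meson set_mono_sublist subsetD)
    then show False by (simp add: set_zimin)
  qed
qed

text \<open>A pair \<open>(B, C)\<close> is a fusion of \<open>u\<close> in the sense of Bean, Ehrenfeucht and McNulty. Letters of
  \<open>B - C\<close> can be deleted, because they can be put back as the letter \<open>0\<close> that separates the letters
  of a Zimin word: at a boundary of fused letters the separator is attached to the left neighbour, at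
  any other boundary to the right one.\<close>

definition fusion :: "'a set \<Rightarrow> 'a set \<Rightarrow> 'a list \<Rightarrow> bool" where
  "fusion B C u \<longleftrightarrow> successively (\<lambda>x y. x \<in> B \<longleftrightarrow> y \<in> C) u"

definition lift_subst :: "'a set \<Rightarrow> 'a set \<Rightarrow> 'a set \<Rightarrow> ('a \<Rightarrow> nat list) \<Rightarrow> 'a \<Rightarrow> nat list" where
  "lift_subst A B C \<phi> x =
     (if x \<in> A then [0]
      else (if x \<in> C then [] else [0]) @ butlast (pad (\<phi> x)) @ (if x \<in> B then [0] else []))"

abbreviation without :: "'a set \<Rightarrow> 'a list \<Rightarrow> 'a list" where
  "without A u \<equiv> filter (\<lambda>x. x \<notin> A) u"

definition unpad :: "nat list \<Rightarrow> nat list" where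
  "unpad w = map (\<lambda>n. n - 1) (filter (\<lambda>n. n \<noteq> 0) w)"

lemma unpad_append [simp]: "unpad (v @ w) = unpad v @ unpad w" "unpad [] = []" "unpad [0] = []"
  by (simp_all add: unpad_def)

lemma butlast_pad: "w \<noteq> [] \<Longrightarrow> butlast (pad w) @ [0] = pad w"
  by (induction w rule: rev_induct) (auto simp: butlast_append)

lemma unpad_pad: "unpad (pad w) = w"
  by (induction w) (auto simp: unpad_def)

lemma unpad_butlast_pad: "unpad (butlast (pad w)) = w"
  by (induction w rule: rev_induct) (auto simp: butlast_append unpad_pad, auto simp: unpad_def)

lemma unpad_lift_subst: "unpad (lift_subst A B C \<phi> x) = (if x \<in> A then [] else \<phi> x)"
  by (simp add: lift_subst_def unpad_butlast_pad)

lemma unpad_subst_lift: "unpad (subst (lift_subst A B C \<phi>) v) = subst \<phi> (without A v)"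
  by (induction v) (simp_all add: unpad_lift_subst)

lemma butlast_pad_simps:
  assumes "w \<noteq> []"
  shows "butlast (pad w) \<noteq> []" "hd (butlast (pad w)) \<noteq> 0" "last (butlast (pad w)) \<noteq> 0"
proof -
  show "butlast (pad w) \<noteq> []" "hd (butlast (pad w)) \<noteq> 0"
    using assms by (cases w; simp)+
  show "last (butlast (pad w)) \<noteq> 0"
    using assms by (induction w rule: rev_induct) (auto simp: butlast_append)
qed

context
  fixes A B C :: "'a set" and \<phi> :: "'a \<Rightarrow> nat list"
  assumes A: "A \<subseteq> B - C" and \<phi>: "nonerasing \<phi>"
begin

lemma nonerasing_lift_subst: "nonerasing (lift_subst A B C \<phi>)"
  using butlast_pad_simps(1) \<phi> by (simp add: lift_subst_def)

lemma hd_lift_subst: "hd (lift_subst A B C \<phi> x) = 0 \<longleftrightarrow> x \<notin> C"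
  using butlast_pad_simps[OF \<phi>[rule_format], of x] A by (auto simp: lift_subst_def)

lemma last_lift_subst: "last (lift_subst A B C \<phi> x) = 0 \<longleftrightarrow> x \<in> B"
  using butlast_pad_simps[OF \<phi>[rule_format], of x] A by (auto simp: lift_subst_def)

lemma lift_subst_pad:
  "lift_subst A B C \<phi> x @ (if x \<in> B then [] else [0]) =
   (if x \<in> C then [] else [0]) @ pad (subst \<phi> (without A [x]))"
  using butlast_pad[OF \<phi>[rule_format], of x] A by (auto simp: lift_subst_def)

text \<open>At each junction the fusion condition makes exactly one of the two neighbours supply the
  separator \<open>0\<close>. Hence the lift differs from the padded word only at the outer
  ends.\<close>

lemma subst_lift_pad:
  "fusion B C u \<Longrightarrow> u \<noteq> [] \<Longrightarrow>
   subst (lift_subst A B C \<phi>) u @ (if last u \<in> B then [] else [0]) =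
   (if hd u \<in> C then [] else [0]) @ pad (subst \<phi> (without A u))"
proof (induction u rule: induct_list012)
  case (2 x)
  then show ?case using lift_subst_pad[of x] by simp
next
  case (3 x y zs)
  have f: "x \<in> B \<longleftrightarrow> y \<in> C" "fusion B C (y # zs)"
    using 3(3) by (auto simp: fusion_def)
  have "subst (lift_subst A B C \<phi>) (x # y # zs) @ (if last (x # y # zs) \<in> B then [] else [0])
      = lift_subst A B C \<phi> x @ (if x \<in> B then [] else [0]) @ pad (subst \<phi> (without A (y # zs)))"
    using 3(2)[OF f(2)] f(1) by simp
  also have "\<dots> = (if x \<in> C then [] else [0]) @ pad (subst \<phi> (without A (x # y # zs)))"
    using arg_cong[OF lift_subst_pad[of x], of "\<lambda>w. w @ pad (subst \<phi> (without A (y # zs)))"] by auto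
  finally show ?case by simp
qed auto

lemma sublist_pad: "sublist w (zimin k) \<Longrightarrow> sublist (0 # pad w) (zimin (Suc k))"
proof -
  assume "sublist w (zimin k)"
  then obtain s t where st: "zimin k = s @ w @ t" by (auto simp: sublist_def)
  have "zimin (Suc k) = butlast (0 # pad s) @ (0 # pad w) @ pad t"
  proof (cases "s = []")
    case False
    then have "pad s \<noteq> []" by (cases s) auto
    moreover have "pad s @ x = butlast (pad s) @ 0 # x" for x
      using butlast_pad[OF False] by (metis append_Cons append_Nil append_assoc)
    ultimately show ?thesis
      by (simp add: st)
  qed (simp add: st)
  then show ?thesis by (metis sublist_appendI)
qed

lemma sublist_lift_subst:
  assumes "fusion B C u" "sublist (subst \<phi> (without A u)) (zimin k)"
  shows "sublist (subst (lift_subst A B C \<phi>) u) (zimin (Suc k))"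
proof (cases "u = []")
  case False
  let ?w = "0 # pad (subst \<phi> (without A u))"
  have "sublist (subst (lift_subst A B C \<phi>) u) ?w"
  proof -
    have "?w = (if hd u \<in> C then [0] else []) @ subst (lift_subst A B C \<phi>) u @ (if last u \<in> B then [] else [0])"
      unfolding subst_lift_pad[OF assms(1) False] by simp
    then show ?thesis unfolding sublist_def by (intro exI)
  qed
  from sublist_order.order_trans[OF this sublist_pad[OF assms(2)]] show ?thesis .
qed (simp del: zimin.simps)

end

lemma fits_insert:
  assumes "fusion B C u" "A \<subseteq> B - C" "fits (without A u)"
  shows "fits u"
proof -
  obtain k \<phi> where \<phi>: "nonerasing \<phi>" "sublist (subst \<phi> (without A u)) (zimin k)"
    using assms(3) by (auto simp: fits_def)
  show ?thesis
    by (rule fitsI[OF nonerasing_lift_subst[OF assms(2) \<phi>(1)] sublist_lift_subst[OF assms(2) \<phi>(1) assms(1) \<phi>(2)]])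
qed

lemma rigid_delete:
  assumes "fusion B C u" "A \<subseteq> B - C" "rigid u v"
  shows "rigid (without A u) (without A v)"
  unfolding rigid_def
proof (intro allI impI)
  fix k \<phi> assume \<phi>: "nonerasing \<phi>" "sublist (subst \<phi> (without A u)) (zimin k)"
  show "subst \<phi> (without A u) = subst \<phi> (without A v)"
    using arg_cong[OF rigidD[OF assms(3) nonerasing_lift_subst[OF assms(2) \<phi>(1)]
      sublist_lift_subst[OF assms(2) \<phi>(1) assms(1) \<phi>(2)]], of unpad]
    by (simp add: unpad_subst_lift)
qed

lemma successively_sublist: "successively P xs \<Longrightarrow> sublist ys xs \<Longrightarrow> successively P ys"
  by (auto simp: sublist_def successively_append_iff)

lemma zimin_alternating: "successively (\<lambda>x y. x = 0 \<longleftrightarrow> y \<noteq> 0) (zimin k)"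
proof -
  have "successively (\<lambda>x y. x = 0 \<longleftrightarrow> y \<noteq> 0) (0 # pad w)" for w
    by (induction w) auto
  then show ?thesis by (cases k) auto
qed

lemma successively_subst:
  assumes "\<forall>x\<in>set u. \<phi> x \<noteq> []"
  shows "successively P (subst \<phi> u) \<longleftrightarrow>
         (\<forall>x\<in>set u. successively P (\<phi> x)) \<and> successively (\<lambda>x y. P (last (\<phi> x)) (hd (\<phi> y))) u"
  using assms
proof (induction u rule: induct_list012)
  case (3 x y zs)
  then show ?case
    by (auto simp: successively_append_iff)
qed auto

lemma hd_subst: "(nonerasing \<phi>) \<Longrightarrow> u \<noteq> [] \<Longrightarrow> hd (subst \<phi> u) = hd (\<phi> (hd u))"
  by (cases u) auto

lemma last_subst: "(nonerasing \<phi>) \<Longrightarrow> u \<noteq> [] \<Longrightarrow> last (subst \<phi> u) = last (\<phi> (last u))"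
  by (cases u rule: rev_cases) auto

text \<open>With nothing deleted, the lift writes membership in \<open>B\<close> and
  \<open>C\<close> into the last and first letters of the images, as being \<open>0\<close> or not.
  Zimin words alternate between \<open>0\<close> and other letters, so reading the common image
  through \<open>v\<close> returns the fusion property for \<open>v\<close>.\<close>

lemma rigid_fusion:
  assumes "fits u" "rigid u v" "fusion B C u" "u \<noteq> []"
  shows "fusion B C v" "v \<noteq> []" "hd u \<in> C \<longleftrightarrow> hd v \<in> C" "last u \<in> B \<longleftrightarrow> last v \<in> B"
proof -
  obtain k \<phi> where \<phi>: "nonerasing \<phi>" "sublist (subst \<phi> u) (zimin k)"
    using assms(1) by (auto simp: fits_def)
  let ?\<psi> = "lift_subst {} B C \<phi>"
  have n: "nonerasing ?\<psi>" using nonerasing_lift_subst[OF empty_subsetI \<phi>(1)] by blast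
  note h = hd_lift_subst[OF empty_subsetI \<phi>(1), of B C] and l = last_lift_subst[OF empty_subsetI \<phi>(1), of B C]
  have s: "sublist (subst ?\<psi> u) (zimin (Suc k))"
    using sublist_lift_subst[OF empty_subsetI \<phi>(1) assms(3)] \<phi>(2) by simp
  note e = rigidD[OF assms(2) n s]
  have "successively (\<lambda>x y. x = 0 \<longleftrightarrow> y \<noteq> 0) (subst ?\<psi> v)"
    using successively_sublist[OF zimin_alternating s] e by simp
  then have "successively (\<lambda>x y. (last (?\<psi> x) = 0) \<longleftrightarrow> (hd (?\<psi> y) \<noteq> 0)) v"
    using successively_subst[of v ?\<psi>] n by simp
  then show "fusion B C v"
    by (simp add: fusion_def h l)
  show v: "v \<noteq> []"
    using e subst_neq_Nil[OF n assms(4)] by auto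
  show "hd u \<in> C \<longleftrightarrow> hd v \<in> C"
    using arg_cong[OF e, of hd] hd_subst[of ?\<psi>, OF n assms(4)] hd_subst[of ?\<psi>, OF n v]
      h[of "hd u"] h[of "hd v"] by simp
  show "last u \<in> B \<longleftrightarrow> last v \<in> B"
    using arg_cong[OF e, of last] last_subst[of ?\<psi>, OF n assms(4)] last_subst[of ?\<psi>, OF n v]
      l[of "last u"] l[of "last v"] by simp
qed

text \<open>Letters are seen as steps from position \<open>s x\<close> to position \<open>e x\<close>. The letters of \<open>D\<close> are deleted
  in ascending order of their end positions, so that the boundaries that get merged always form an
  initial segment of the positions.\<close>

definition linked :: "('a \<Rightarrow> nat) \<Rightarrow> ('a \<Rightarrow> nat) \<Rightarrow> nat \<Rightarrow> 'a list \<Rightarrow> bool" where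
  "linked s e j u \<longleftrightarrow> successively (\<lambda>x y. e x = s y \<or> e x < j \<and> s y < j) u"

lemma linked_without:
  assumes "linked s e j u" "\<And>x. x \<in> A \<Longrightarrow> e x = j \<and> s x < j"
  shows "linked s e (Suc j) (without A u)"
proof -
  \<comment> \<open>The extra conjunct carries the induction: a deleted letter ends at
    \<open>j\<close>, outside the exception below \<open>j\<close>, so its successor starts exactly
    at \<open>j\<close> and is not deleted itself.\<close>
  have "linked s e (Suc j) (without A u) \<and>
     (u \<noteq> [] \<longrightarrow> hd u \<in> A \<longrightarrow> without A u \<noteq> [] \<longrightarrow> s (hd (without A u)) = j)"
    using assms(1)
  proof (induction u)
    case (Cons x u)
    have l: "linked s e j u" using Cons(2) by (cases u) (auto simp: linked_def)
    note IH = Cons.IH[OF l]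
    show ?case
    proof (cases u)
      case (Cons y w)
      have xy: "e x = s y \<or> e x < j \<and> s y < j"
        using Cons.prems Cons by (auto simp: linked_def)
      show ?thesis
      proof (cases "without A u")
        case Nil
        then show ?thesis by (auto simp: linked_def)
      next
        case (Cons z w')
        have "(s z = j \<and> y \<in> A) \<or> (z = y \<and> y \<notin> A)"
          using IH Cons \<open>u = y # w\<close> by (cases "y \<in> A") simp_all
        then show ?thesis
          using IH Cons xy assms(2)[of x] assms(2)[of y] \<open>u = y # w\<close>
          by (auto simp: linked_def)
      qed
    qed (auto simp: linked_def)
  qed (auto simp: linked_def)
  then show ?thesis by blast
qed

lemma linked_fusion: "linked s e j u \<Longrightarrow> fusion {x. e x \<ge> j} {x. s x \<ge> j} u"
  unfolding linked_def fusion_def by (erule successively_mono) auto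

lemma linked_delete:
  assumes "linked s e 0 u" "\<And>x. x \<in> D \<Longrightarrow> s x < e x"
  shows "linked s e j (without {x \<in> D. e x < j} u) \<and>
         (fits (without {x \<in> D. e x < j} u) \<longrightarrow> fits u) \<and>
         (rigid u v \<longrightarrow> rigid (without {x \<in> D. e x < j} u) (without {x \<in> D. e x < j} v))"
proof (induction j)
  case 0
  then show ?case using assms(1) by simp
next
  case (Suc j)
  let ?u = "without {x \<in> D. e x < j} u" and ?v = "without {x \<in> D. e x < j} v" and ?A = "{x \<in> D. e x = j}"
  have w: "without {x \<in> D. e x < Suc j} w = without ?A (without {x \<in> D. e x < j} w)" for w
    by (simp, rule filter_cong) auto
  have l: "linked s e j ?u" using Suc by blast
  have A: "?A \<subseteq> {x. e x \<ge> j} - {x. s x \<ge> j}" using assms(2) by fastforce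
  have "linked s e (Suc j) (without ?A ?u)"
    using assms(2) by (intro linked_without[OF l]) auto
  then show ?case
    unfolding w using Suc fits_insert[OF linked_fusion[OF l] A] rigid_delete[OF linked_fusion[OF l] A] by blast
qed

lemma
  assumes "successively (\<lambda>x y. e x = s y) u" "\<And>x. x \<in> D \<Longrightarrow> s x < (e x :: nat)" "\<And>x. x \<in> D \<Longrightarrow> e x < N"
  shows fits_insert_all: "fits (without D u) \<Longrightarrow> fits u"
    and rigid_delete_all: "rigid u v \<Longrightarrow> rigid (without D u) (without D v)"
proof -
  have "linked s e 0 u" using assms(1) by (simp add: linked_def)
  moreover have "{x \<in> D. e x < N} = D" using assms(3) by auto
  ultimately show "fits (without D u) \<Longrightarrow> fits u" "rigid u v \<Longrightarrow> rigid (without D u) (without D v)"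
    using linked_delete[of s e u D N v] assms(2) by auto
qed

section \<open>The substitution on a matrix alphabet and its decoding\<close>

section \<open>Block words\<close>

type_synonym letter = "nat \<times> nat"

text \<open>The letter \<open>(i, j)\<close> will be replaced by
  \<open>(0, i) (1, j) (2, i) (3, j) ...\<close>. Storing one index per letter keeps the letters
  inside an \<open>r\<close> by \<open>r\<close> alphabet, so the substitution can be
  iterated.\<close>

definition entry :: "nat \<Rightarrow> letter \<Rightarrow> letter" where
  "entry k b = (k, if even k then fst b else snd b)"

definition block :: "nat \<Rightarrow> letter \<Rightarrow> letter list" where
  "block r b = map (\<lambda>k. entry k b) [0..<r]"

definition cyclic :: "nat \<Rightarrow> letter list \<Rightarrow> bool" where
  "cyclic r w \<longleftrightarrow> successively (\<lambda>a b. fst b = Suc (fst a) mod r) w"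

lemma fst_entry [simp]: "fst (entry k b) = k"
  by (simp add: entry_def)

lemma length_block [simp]: "length (block r b) = r"
  by (simp add: block_def)

lemma hd_block: "0 < r \<Longrightarrow> hd (block r b) = entry 0 b"
  by (simp add: block_def hd_map)

lemma last_block: "0 < r \<Longrightarrow> last (block r b) = entry (r - 1) b"
  by (simp add: block_def last_map)

lemma set_block: "set (block r b) = (\<lambda>k. entry k b) ` {..<r}"
  by (auto simp: block_def)

lemma filter_block: "i < r \<Longrightarrow> filter (\<lambda>a. fst a = i) (block r b) = [entry i b]"
proof (induction r)
  case (Suc r)
  have "filter (\<lambda>a. fst a = i) (block r b) = []" if "i = r"
    using that by (auto simp: block_def filter_map o_def filter_empty_conv)
  then show ?case
    using Suc by (cases "i = r") (auto simp: block_def less_Suc_eq)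
qed simp

lemma block_neq_Nil: "0 < r \<Longrightarrow> block r b \<noteq> []"
  by (simp add: block_def)

lemma cyclic_blocks:
  assumes "0 < r"
  shows "cyclic r (subst (block r) B)"
proof -
  have "successively (\<lambda>a b. fst b = Suc (fst a) mod r) (block r b)" for b
    unfolding block_def successively_map successively_conv_nth by auto
  moreover have "fst (hd (block r b)) = Suc (fst (last (block r b'))) mod r" for b b'
    using assms by (simp add: hd_block last_block)
  moreover have "successively (\<lambda>a b. True) B"
    by (simp add: successively_conv_nth)
  ultimately show ?thesis
    unfolding cyclic_def using block_neq_Nil[OF assms] by (subst successively_subst) auto
qed

text \<open>The current column forces the next one, so the columns can interleave in only one way.
  This permits the later arguments to treat each column separately.\<close>

lemma cyclic_eqI:
  assumes "cyclic r w" "cyclic r w'" "w \<noteq> [] \<Longrightarrow> w' \<noteq> [] \<Longrightarrow> fst (hd w) = fst (hd w')"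
    and "\<And>i. filter (\<lambda>a. fst a = i) w = filter (\<lambda>a. fst a = i) w'"
  shows "w = w'"
  using assms
proof (induction w arbitrary: w')
  case Nil
  show ?case
  proof (cases w')
    case (Cons a w1)
    then show ?thesis using Nil(4)[of "fst a"] by simp
  qed simp
next
  case (Cons a w)
  obtain a' w1 where w': "w' = a' # w1"
    using Cons.prems(4)[of "fst a"] by (cases w') auto
  have a: "fst a' = fst a" using Cons.prems(3) w' by simp
  have aa: "a = a'" "filter (\<lambda>c. fst c = fst a) w = filter (\<lambda>c. fst c = fst a) w1"
    using Cons.prems(4)[of "fst a"] a w' by auto
  have "w = w1"
  proof (rule Cons.IH)
    show "cyclic r w" "cyclic r w1"
      using Cons.prems(1,2) w' by (auto simp: cyclic_def successively_Cons)
    show "fst (hd w) = fst (hd w1)" if "w \<noteq> []" "w1 \<noteq> []"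
      using Cons.prems(1,2) w' that a by (auto simp: cyclic_def successively_Cons)
    show "filter (\<lambda>c. fst c = i) w = filter (\<lambda>c. fst c = i) w1" for i
      using Cons.prems(4)[of i] aa w' by (cases "i = fst a") auto
  qed
  then show ?case using aa w' by simp
qed

lemma blocks_split_start:
  assumes "subst (block r) B = s @ t" "t \<noteq> []"
  obtains B1 b B2 k where "B = B1 @ b # B2" "s = subst (block r) B1 @ take k (block r b)"
    "t = drop k (block r b) @ subst (block r) B2" "k < r" "fst (hd t) = k"
  using assms
proof (induction B arbitrary: s thesis)
  case (Cons b B)
  show ?case
  proof (cases "length s < r")
    case True
    have e: "block r b @ subst (block r) B = s @ t"
      using Cons.prems(2) by simp
    have "s = take (length s) (block r b @ subst (block r) B)"
      unfolding e by simp
    moreover have "t = drop (length s) (block r b @ subst (block r) B)"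
      unfolding e by simp
    moreover from this have "hd t = entry (length s) b"
      using True by (simp add: hd_append hd_drop_conv_nth) (simp add: block_def)
    ultimately show ?thesis
      using True by (intro Cons.prems(1)[of "[]" b B "length s"]) auto
  next
    case False
    have "block r b @ subst (block r) B = take r s @ drop r s @ t"
      using Cons.prems(2) False by simp
    moreover have "length (take r s) = length (block r b)"
      using False by simp
    ultimately have e: "block r b = take r s" "subst (block r) B = drop r s @ t"
      using append_eq_append_conv[of "take r s" "block r b" "drop r s @ t" "subst (block r) B"] by auto
    then have "s = block r b @ drop r s" "subst (block r) B = drop r s @ t"
      by (simp only: append_take_drop_id) (rule e(2))
    then show ?thesis
      using Cons.IH[of "drop r s"] Cons.prems(1,3)
      by (metis (no_types, opaque_lifting) append_Cons append_assoc concat.simps(2) list.simps(9))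
  qed
qed auto

lemma blocks_split_end:
  assumes "subst (block r) B = s @ t" "s \<noteq> []"
  obtains B1 b B2 k where "B = B1 @ b # B2" "s = subst (block r) B1 @ take (Suc k) (block r b)"
    "t = drop (Suc k) (block r b) @ subst (block r) B2" "k < r" "fst (last s) = k"
proof -
  have "subst (block r) B = butlast s @ last s # t"
    using assms by simp
  then obtain B1 b B2 k where *: "B = B1 @ b # B2" "butlast s = subst (block r) B1 @ take k (block r b)"
    "last s # t = drop k (block r b) @ subst (block r) B2" "k < r" "fst (hd (last s # t)) = k"
    by (rule blocks_split_start) auto
  have d: "drop k (block r b) = block r b ! k # drop (Suc k) (block r b)"
    using *(4) by (simp add: Cons_nth_drop_Suc)
  then have "last s = block r b ! k" "t = drop (Suc k) (block r b) @ subst (block r) B2"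
    using *(3) by simp_all
  moreover have "s = butlast s @ [last s]" using assms(2) by simp
  ultimately have "s = subst (block r) B1 @ take (Suc k) (block r b)"
    using *(2,4) by (metis append_assoc length_block take_Suc_conv_app_nth)
  then show thesis
    using * \<open>t = _\<close> by (intro that[of B1 b B2 k]) auto
qed

text \<open>A letter does not determine the block that contains it, but two adjacent letters of a block do.\<close>

definition block_of :: "nat \<Rightarrow> letter \<Rightarrow> letter \<Rightarrow> letter" where
  "block_of k a a' = (if even k then (snd a, snd a') else (snd a', snd a))"

lemma block_of_entry [simp]: "block_of k (entry k b) (entry (Suc k) b) = b"
  by (cases b) (simp add: block_of_def entry_def)

text \<open>Only pairs that start in column \<open>k\<close> are read, so a cut after any other
  column neither loses nor duplicates a block.\<close>

fun blocks_of :: "nat \<Rightarrow> letter list \<Rightarrow> letter list" where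
  "blocks_of k (a # a' # w) = (if fst a = k then [block_of k a a'] else []) @ blocks_of k (a' # w)"
| "blocks_of k w = []"

lemma blocks_of_append: "v = [] \<or> fst (last v) \<noteq> k \<Longrightarrow> blocks_of k (v @ w) = blocks_of k v @ blocks_of k w"
proof (induction v rule: induct_list012)
  case (2 x)
  then show ?case by (cases w) auto
qed auto

lemma blocks_of_no_column: "(\<And>a. a \<in> set w \<Longrightarrow> fst a \<noteq> k) \<Longrightarrow> blocks_of k w = []"
  by (induction w rule: induct_list012) auto

lemma blocks_of_block:
  assumes "Suc k < r"
  shows "blocks_of k (block r b) = [b]"
proof -
  have "[0..<r] = [0..<k] @ k # Suc k # [Suc (Suc k)..<r]"
    using assms upt_add_eq_append[of 0 k "r - k"] by (simp add: upt_conv_Cons)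
  then have b: "block r b = map (\<lambda>j. entry j b) [0..<k] @ entry k b # entry (Suc k) b # map (\<lambda>j. entry j b) [Suc (Suc k)..<r]"
    by (simp add: block_def)
  have "blocks_of k (map (\<lambda>j. entry j b) [0..<k]) = []"
    by (rule blocks_of_no_column) auto
  moreover have "blocks_of k (entry (Suc k) b # map (\<lambda>j. entry j b) [Suc (Suc k)..<r]) = []"
    by (rule blocks_of_no_column) (auto simp: entry_def)
  ultimately show ?thesis
    unfolding b by (subst blocks_of_append) (auto simp: last_map)
qed

lemma blocks_of_blocks:
  assumes "Suc k < r"
  shows "blocks_of k (subst (block r) B) = B"
proof (induction B)
  case (Cons b B)
  have "fst (last (block r b)) \<noteq> k" using assms by (simp add: last_block)
  then show ?case using Cons assms by (simp add: blocks_of_append blocks_of_block)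
qed simp

text \<open>The outermost blocks may be incomplete in \<open>w\<close>, but both still contain their
  letters in columns \<open>k\<close> and \<open>k + 1\<close>. They are thus read off
  \<open>w\<close>, and what is missing is known.\<close>

lemma core_complete:
  assumes k: "Suc k < r" and sub: "sublist w (subst (block r) B)" and w: "w \<noteq> []"
    and h: "fst (hd w) = k" and l: "fst (last w) = Suc k"
  defines "C \<equiv> blocks_of k w"
  shows "C \<noteq> []" "subst (block r) C = take k (block r (hd C)) @ w @ drop (k + 2) (block r (last C))"
proof -
  obtain s t where st: "subst (block r) B = s @ (w @ t)"
    using sub by (auto simp: sublist_def)
  obtain B1 b B2 where 1: "w @ t = drop k (block r b) @ subst (block r) B2"
    using blocks_split_start[OF st] w h by (metis Nil_is_append_conv hd_append2)
  then have e: "subst (block r) (b # B2) = (take k (block r b) @ w) @ t"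
    by simp
  obtain B3 c B4 where 2: "b # B2 = B3 @ c # B4"
     "take k (block r b) @ w = subst (block r) B3 @ take (Suc (Suc k)) (block r c)"
  proof (rule blocks_split_end[OF e])
    fix B3 c B4 j
    assume *: "b # B2 = B3 @ c # B4" "take k (block r b) @ w = subst (block r) B3 @ take (Suc j) (block r c)"
      "fst (last (take k (block r b) @ w)) = j"
    have "j = Suc k" using *(3) w l by (metis last_appendR)
    then show thesis using that[OF *(1)] *(2) by blast
  qed (use w in auto)
  let ?C = "B3 @ [c]"
  have hC: "hd ?C = b" using 2(1) by (cases B3) auto
  have eq: "subst (block r) ?C = take k (block r (hd ?C)) @ w @ drop (k + 2) (block r (last ?C))"
    unfolding hC using arg_cong[OF 2(2), of "\<lambda>x. x @ drop (k + 2) (block r c)"] by simp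
  have t: "blocks_of k (take k (block r b)) = []" for b
    using k by (intro blocks_of_no_column) (auto simp: block_def take_map)
  have d: "blocks_of k (drop (k + 2) (block r b)) = []" for b
    by (rule blocks_of_no_column) (auto simp: block_def drop_map)
  have tl: "take k (block r b) = [] \<or> fst (last (take k (block r b))) \<noteq> k" for b
    using k by (cases "k = 0") (auto simp: block_def take_map last_map)
  have "?C = blocks_of k (take k (block r (hd ?C)) @ w @ drop (k + 2) (block r (last ?C)))"
    using blocks_of_blocks[OF k, of ?C] eq by simp
  also have "\<dots> = blocks_of k w"
    using w l t d by (subst blocks_of_append[OF tl], subst blocks_of_append) auto
  finally have C: "C = ?C" by (simp add: C_def)
  show "C \<noteq> []" "subst (block r) C = take k (block r (hd C)) @ w @ drop (k + 2) (block r (last C))"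
    unfolding C using eq by auto
qed

lemma filter_blocks: "i < r \<Longrightarrow> filter (\<lambda>a. fst a = i) (subst (block r) B) = map (entry i) B"
  by (induction B) (simp_all add: filter_block)

lemma filter_take_block: "filter (\<lambda>a. fst a = i) (take k (block r b)) = (if i < k \<and> i < r then [entry i b] else [])"
proof -
  have "take k (block r b) = block (min k r) b"
    by (simp add: block_def take_map min_def)
  then show ?thesis
    using filter_block[of i "min k r" b] by (auto simp: filter_empty_conv set_block)
qed

lemma filter_drop_block: "filter (\<lambda>a. fst a = i) (drop k (block r b)) = (if k \<le> i \<and> i < r then [entry i b] else [])"
proof -
  have "filter (\<lambda>a. fst a = i) (take k (block r b)) @ filter (\<lambda>a. fst a = i) (drop k (block r b)) =
        (if i < r then [entry i b] else [])"
    using filter_block[of i r b] by (auto simp flip: filter_append simp: filter_empty_conv set_block)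
  then show ?thesis
    by (auto simp: filter_take_block split: if_splits)
qed

lemma filter_core:
  assumes "Suc k < r" "sublist w (subst (block r) B)" "w \<noteq> []" "fst (hd w) = k" "fst (last w) = Suc k" "i < r"
  shows "(if i < k then [entry i (hd (blocks_of k w))] else []) @ filter (\<lambda>a. fst a = i) w @
         (if k + 2 \<le> i then [entry i (last (blocks_of k w))] else []) = map (entry i) (blocks_of k w)"
  using arg_cong[OF core_complete(2)[OF assms(1-5)], of "filter (\<lambda>a. fst a = i)"] assms(1,6)
  unfolding filter_append filter_take_block filter_drop_block filter_blocks[OF assms(6)] by (auto split: if_splits)

section \<open>Pulling back a factorization with an uncut pair of columns\<close>

section \<open>Factorizations of block words\<close>

text \<open>Long letters are those whose image contains the whole pair of columns \<open>k\<close> and \<open>k + 1\<close> of some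
  block, which identifies the block. Everything outside the cores of the long letters is cut into
  single letters, the short pieces.\<close>

locale block_factorization =
  fixes r k :: nat and \<theta> :: "nat \<Rightarrow> letter list" and u :: "nat list" and B :: "letter list"
  assumes k: "Suc k < r" and nonerasing: "nonerasing \<theta>" and u: "u \<noteq> []"
    and \<theta>u: "subst \<theta> u = subst (block r) B"
    and no_cut: "\<And>x. x \<in> set u \<Longrightarrow> fst (hd (\<theta> x)) \<noteq> Suc k"
begin

definition long :: "nat \<Rightarrow> bool" where
  "long x \<longleftrightarrow> k \<in> fst ` set (\<theta> x)"

definition pre :: "nat \<Rightarrow> letter list" where
  "pre x = takeWhile (\<lambda>a. fst a \<noteq> k) (\<theta> x)"

definition core :: "nat \<Rightarrow> letter list" where
  "core x = rev (dropWhile (\<lambda>a. fst a \<noteq> Suc k) (rev (dropWhile (\<lambda>a. fst a \<noteq> k) (\<theta> x))))"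

definition post :: "nat \<Rightarrow> letter list" where
  "post x = rev (takeWhile (\<lambda>a. fst a \<noteq> Suc k) (rev (dropWhile (\<lambda>a. fst a \<noteq> k) (\<theta> x))))"

definition \<psi> :: "nat \<Rightarrow> letter list" where
  "\<psi> x = blocks_of k (\<theta> x)"

definition pieces :: "nat \<Rightarrow> (nat + letter) list" where
  "pieces x = (if long x then map Inr (pre x) @ [Inl x] @ map Inr (post x) else map Inr (\<theta> x))"

fun val :: "nat + letter \<Rightarrow> letter list" where
  "val (Inl x) = core x"
| "val (Inr a) = [a]"

fun first_col :: "nat + letter \<Rightarrow> nat" where
  "first_col (Inl x) = k"
| "first_col (Inr a) = fst a"

fun last_col :: "nat + letter \<Rightarrow> nat" where
  "last_col (Inl x) = Suc k"
| "last_col (Inr a) = fst a"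

abbreviation shorts :: "nat set \<Rightarrow> (nat + letter) set" where
  "shorts I \<equiv> Inr ` {a. fst a \<in> I}"

lemma theta_eq: "\<theta> x = pre x @ core x @ post x"
  by (simp add: pre_def core_def post_def flip: rev_append)

lemma subst_val_Inr [simp]: "subst val (map Inr w) = w"
  by (induction w) auto

lemma subst_val_pieces: "subst val (pieces x) = \<theta> x"
proof (cases "long x")
  case True
  have "subst val (pieces x) = subst val (map Inr (pre x)) @ core x @ subst val (map Inr (post x))"
    using True by (simp add: pieces_def)
  then show ?thesis
    unfolding subst_val_Inr by (simp flip: theta_eq)
next
  case False
  then show ?thesis
    by (simp only: pieces_def if_False subst_val_Inr)
qed

lemma subst_val: "subst val (subst pieces v) = subst \<theta> v"
  by (simp add: concat_map_subst subst_val_pieces)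

lemma nonerasing_pieces: "nonerasing pieces"
  using nonerasing by (simp add: pieces_def)

lemma theta_sublist: "x \<in> set u \<Longrightarrow> sublist (\<theta> x) (subst (block r) B)"
  unfolding \<theta>u[symmetric] by (metis in_set_conv_decomp concat_append concat.simps(2) list.map(2) map_append sublist_appendI)

lemma theta_cyclic: "x \<in> set u \<Longrightarrow> cyclic r (\<theta> x)"
  using successively_sublist theta_sublist cyclic_blocks k unfolding cyclic_def by (metis less_zeroE not_gr_zero)

lemma theta_col: "x \<in> set u \<Longrightarrow> a \<in> set (\<theta> x) \<Longrightarrow> fst a < r"
  using set_mono_sublist[OF theta_sublist] by (fastforce simp: set_block)

lemma B: "B \<noteq> []"
  using u \<theta>u nonerasing by (cases u) auto

lemma hd_theta: "fst (hd (\<theta> (hd u))) = 0"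
  using hd_subst[OF nonerasing u] \<theta>u B k hd_block[of r "hd B"] block_neq_Nil[of r] by (cases B) auto

lemma last_theta: "fst (last (\<theta> (last u))) = r - 1"
  using last_subst[OF nonerasing u] \<theta>u B k last_block[of r "last B"] block_neq_Nil[of r]
  by (cases B rule: rev_cases) auto

lemma adjacent_theta: "successively (\<lambda>x y. fst (hd (\<theta> y)) = Suc (fst (last (\<theta> x))) mod r) u"
  using cyclic_blocks[of r B] k nonerasing successively_subst[of u \<theta>]
  unfolding \<theta>u[symmetric] cyclic_def by simp

lemma no_cut_last: "x \<in> set u \<Longrightarrow> fst (last (\<theta> x)) \<noteq> k"
proof
  assume x: "x \<in> set u" "fst (last (\<theta> x)) = k"
  then obtain v w where v: "u = v @ x # w" by (meson split_list)
  show False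
  proof (cases w)
    case Nil
    then show False using last_theta x v k by simp
  next
    case (Cons y w')
    then show False
      using adjacent_theta no_cut[of y] x(2) k unfolding v by (simp add: successively_append_iff)
  qed
qed

lemma cyclic_successor:
  assumes "cyclic r w" "w \<noteq> []" "fst (last w) \<noteq> k" "a \<in> set w" "fst a = k"
  shows "\<exists>a'\<in>set w. fst a' = Suc k"
  using assms
proof (induction w rule: induct_list012)
  case (3 x y zs)
  then show ?case using k by (auto simp: cyclic_def)
qed auto

lemma cyclic_predecessor:
  assumes "cyclic r w" "w \<noteq> []" "fst (hd w) \<noteq> Suc k" "a \<in> set w" "fst a = Suc k" "\<And>a. a \<in> set w \<Longrightarrow> fst a < r"
  shows "\<exists>a'\<in>set w. fst a' = k"
  using assms
proof (induction w rule: induct_list012)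
  case (3 x y zs)
  have "fst x = k" if "fst y = Suc k"
    using that 3(3) 3(8)[of x] by (auto simp: cyclic_def mod_Suc split: if_splits)
  then show ?case using 3 by (cases "fst y = Suc k") (auto simp: cyclic_def)
qed auto

text \<open>A letter of column \<open>k + 1\<close> in \<open>pre x\<close> either is preceded by
  one of column \<open>k\<close>, which \<open>pre x\<close> excludes, or begins the image, which
  \<open>no_cut\<close> excludes.\<close>

lemma pre_cols:
  assumes "x \<in> set u" "a \<in> set (pre x)"
  shows "fst a \<notin> {k, Suc k}" "fst a < r"
proof -
  have p: "prefix (pre x) (\<theta> x)" using theta_eq[of x] by simp
  have a: "a \<in> set (\<theta> x)" using assms(2) theta_eq[of x] by (metis Un_iff set_append)
  show "fst a < r" using theta_col[OF assms(1) a] .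
  have nk: "fst a' \<noteq> k" if "a' \<in> set (pre x)" for a'
    using that set_takeWhileD[of a' _ "\<theta> x"] unfolding pre_def by blast
  have "fst a \<noteq> Suc k"
  proof
    assume "fst a = Suc k"
    moreover have "cyclic r (pre x)"
      using theta_cyclic[OF assms(1)] p prefix_imp_sublist successively_sublist unfolding cyclic_def by blast
    moreover have "pre x \<noteq> []" using assms(2) by auto
    moreover have "hd (pre x) = hd (\<theta> x)"
      using p \<open>pre x \<noteq> []\<close> by (auto simp: prefix_def)
    moreover have "fst a' < r" if "a' \<in> set (pre x)" for a'
      using theta_col[OF assms(1)] that p set_mono_prefix by blast
    ultimately show False
      using cyclic_predecessor[of "pre x" a] nk no_cut[OF assms(1)] assms(2) by auto
  qed
  then show "fst a \<notin> {k, Suc k}" using nk[OF assms(2)] by simp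
qed

lemma post_cols:
  assumes "x \<in> set u" "a \<in> set (post x)"
  shows "fst a \<notin> {k, Suc k}" "fst a < r"
proof -
  have p: "suffix (post x) (\<theta> x)" using theta_eq[of x] by (metis append.assoc suffixI)
  have a: "a \<in> set (\<theta> x)" using assms(2) theta_eq[of x] by (metis Un_iff set_append)
  show "fst a < r" using theta_col[OF assms(1) a] .
  have nk: "fst a' \<noteq> Suc k" if "a' \<in> set (post x)" for a'
    using that set_takeWhileD unfolding post_def set_rev by fast
  have "fst a \<noteq> k"
  proof
    assume "fst a = k"
    moreover have "cyclic r (post x)"
      using theta_cyclic[OF assms(1)] p suffix_imp_sublist successively_sublist unfolding cyclic_def by blast
    moreover have "post x \<noteq> []" using assms(2) by auto
    moreover have "last (post x) = last (\<theta> x)"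
      using p \<open>post x \<noteq> []\<close> by (auto simp: suffix_def)
    ultimately show False
      using cyclic_successor[of "post x" a] nk no_cut_last[OF assms(1)] assms(2) by auto
  qed
  then show "fst a \<notin> {k, Suc k}" using nk[OF assms(2)] by simp
qed

lemma core_props:
  assumes "x \<in> set u" "long x"
  shows "core x \<noteq> []" "fst (hd (core x)) = k" "fst (last (core x)) = Suc k"
proof -
  let ?w = "dropWhile (\<lambda>a. fst a \<noteq> k) (\<theta> x)"
  obtain a where a: "a \<in> set (\<theta> x)" "fst a = k" using assms(2) by (auto simp: long_def)
  have w: "?w \<noteq> []" using a by (auto simp: dropWhile_eq_Nil_conv)
  have hw: "fst (hd ?w) = k" using hd_dropWhile[OF w] by simp
  have s: "suffix ?w (\<theta> x)" by (rule suffix_dropWhile)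
  have "cyclic r ?w"
    using theta_cyclic[OF assms(1)] s suffix_imp_sublist successively_sublist unfolding cyclic_def by blast
  moreover have "last ?w = last (\<theta> x)" using s w by (metis last_appendR suffix_def)
  ultimately obtain a' where a': "a' \<in> set ?w" "fst a' = Suc k"
    using cyclic_successor[of ?w "hd ?w"] hw w no_cut_last[OF assms(1)] by auto
  let ?c = "dropWhile (\<lambda>a. fst a \<noteq> Suc k) (rev ?w)"
  have c: "?c \<noteq> []" using a' by (auto simp: dropWhile_eq_Nil_conv)
  then show 1: "core x \<noteq> []" by (simp add: core_def)
  show "fst (last (core x)) = Suc k"
    using hd_dropWhile[OF c] c unfolding core_def by (simp add: last_rev)
  have "?w = core x @ post x" by (simp add: core_def post_def flip: rev_append)
  then show "fst (hd (core x)) = k" using hw 1 by simp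
qed

lemma core_sublist: "x \<in> set u \<Longrightarrow> sublist (core x) (subst (block r) B)"
  using theta_sublist theta_eq by (metis sublist_appendI sublist_order.order_trans)

lemma psi_core:
  assumes "x \<in> set u" "long x"
  shows "\<psi> x = blocks_of k (core x)"
proof -
  have "blocks_of k (pre x) = []" "blocks_of k (post x) = []"
    using pre_cols(1)[OF assms(1)] post_cols(1)[OF assms(1)] by (intro blocks_of_no_column; blast)+
  moreover have "pre x = [] \<or> fst (last (pre x)) \<noteq> k"
    using pre_cols(1)[OF assms(1)] last_in_set by blast
  ultimately show ?thesis
    unfolding \<psi>_def theta_eq[of x] using core_props[OF assms] by (simp add: blocks_of_append)
qed

lemma psi_not_long: "\<not> long x \<Longrightarrow> \<psi> x = []"
  unfolding \<psi>_def by (rule blocks_of_no_column) (auto simp: long_def)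

lemma subst_psi: "set v \<subseteq> set u \<Longrightarrow> subst \<psi> v = blocks_of k (subst \<theta> v)"
proof (induction v)
  case (Cons x v)
  then show ?case
    using no_cut_last[of x] by (simp add: \<psi>_def blocks_of_append)
qed simp

lemma subst_psi_u: "subst \<psi> u = B"
  using subst_psi[of u] \<theta>u blocks_of_blocks[OF k] by simp

lemma subst_psi_long: "subst \<psi> (filter long v) = subst \<psi> v"
  by (induction v) (auto simp: psi_not_long)

lemma psi_neq_Nil: "x \<in> set u \<Longrightarrow> long x \<Longrightarrow> \<psi> x \<noteq> []"
  using core_complete(1)[OF k core_sublist] core_props psi_core by simp

lemma pieces_cols:
  assumes "x \<in> set u" "p \<in> set (pieces x)"
  shows "p = Inl x \<and> long x \<or> p \<in> shorts ({..<r} - {k, Suc k})"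
proof (cases "long x")
  case True
  then show ?thesis using assms pre_cols[OF assms(1)] post_cols[OF assms(1)]
    by (auto simp: pieces_def)
next
  case False
  have "fst a \<noteq> Suc k" if "a \<in> set (\<theta> x)" for a
  proof
    assume "fst a = Suc k"
    then have "\<exists>a'\<in>set (\<theta> x). fst a' = k"
      using theta_col theta_cyclic nonerasing no_cut assms(1) that
      by (intro cyclic_predecessor[of _ a]) auto
    then show False using False by (force simp: long_def)
  qed
  moreover have "fst a \<noteq> k" if "a \<in> set (\<theta> x)" for a
    using that False by (auto simp: long_def)
  ultimately show ?thesis using assms theta_col[OF assms(1)] False by (auto simp: pieces_def)
qed

lemma val_cols:
  assumes "set v \<subseteq> set u" "p \<in> set (subst pieces v)"
  shows "val p \<noteq> []" "fst (hd (val p)) = first_col p" "fst (last (val p)) = last_col p"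
    "(\<exists>x. p = Inl x \<and> x \<in> set v \<and> long x) \<or> p \<in> shorts ({..<r} - {k, Suc k})"
proof -
  obtain x where x: "x \<in> set v" "p \<in> set (pieces x)" using assms(2) by auto
  then have xu: "x \<in> set u" using assms(1) by auto
  show "(\<exists>x. p = Inl x \<and> x \<in> set v \<and> long x) \<or> p \<in> shorts ({..<r} - {k, Suc k})"
    using pieces_cols[OF xu x(2)] x(1) by auto
  show "val p \<noteq> []" "fst (hd (val p)) = first_col p" "fst (last (val p)) = last_col p"
    using pieces_cols[OF xu x(2)] core_props[OF xu] by auto
qed

lemma filter_Inr: "filter (\<lambda>p. p \<notin> shorts I) (map Inr w) = (map Inr (filter (\<lambda>a. fst a \<notin> I) w) :: (nat + letter) list)"
  by (induction w) auto

lemma without_shorts: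
  assumes "set v \<subseteq> set u"
  shows "without (shorts ({..<r} - {k, Suc k})) (subst pieces v) = map Inl (filter long v)"
  using assms
proof (induction v)
  case (Cons x v)
  then have x: "x \<in> set u" by simp
  have "without (shorts ({..<r} - {k, Suc k})) (pieces x) = (if long x then [Inl x] else [])"
  proof (cases "long x")
    case True
    have "filter (\<lambda>a. fst a \<notin> {..<r} - {k, Suc k}) (pre x) = []" "filter (\<lambda>a. fst a \<notin> {..<r} - {k, Suc k}) (post x) = []"
      using pre_cols[OF x] post_cols[OF x] by (auto simp: filter_empty_conv)
    then show ?thesis using True
      unfolding pieces_def by (simp only: if_True filter_append filter_Inr) auto
  next
    case False
    have "p \<in> shorts ({..<r} - {k, Suc k})" if "p \<in> set (pieces x)" for p
      using pieces_cols[OF x that] False by simp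
    then have "without (shorts ({..<r} - {k, Suc k})) (pieces x) = []"
      by (simp add: filter_empty_conv)
    then show ?thesis using False by simp
  qed
  then show ?case using Cons by simp
qed simp

lemma adjacent_pieces: "successively (\<lambda>p q. first_col q = Suc (last_col p) mod r) (subst pieces u)"
proof -
  have "successively (\<lambda>a b. fst b = Suc (fst a) mod r) (subst val (subst pieces u))"
    using cyclic_blocks[of r B] k unfolding subst_val \<theta>u cyclic_def by simp
  moreover have "\<forall>p\<in>set (subst pieces u). val p \<noteq> []"
    using val_cols(1)[OF subset_refl] by blast
  ultimately have "successively (\<lambda>p q. fst (hd (val q)) = Suc (fst (last (val p))) mod r) (subst pieces u)"
    by (simp only: successively_subst)
  then show ?thesis
    by (rule successively_cong[THEN iffD1, rotated -1]) (use val_cols(2,3)[OF subset_refl] in auto)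
qed

end

lemma successively_mono_set:
  "successively P xs \<Longrightarrow> (\<And>x y. x \<in> set xs \<Longrightarrow> y \<in> set xs \<Longrightarrow> P x y \<Longrightarrow> Q x y) \<Longrightarrow> successively Q xs"
  by (induction xs rule: induct_list012) auto

lemma filter_eq_upt: "filter (\<lambda>j. j = i) [a..<b] = (if a \<le> i \<and> i < b then [i] else [])"
  by (induction b) auto

lemma hd_filter: "xs \<noteq> [] \<Longrightarrow> P (hd xs) \<Longrightarrow> hd (filter P xs) = hd xs"
  by (cases xs) auto

lemma last_filter: "xs \<noteq> [] \<Longrightarrow> P (last xs) \<Longrightarrow> last (filter P xs) = last xs"
  by (cases xs rule: rev_cases) auto

lemma subst_eqD:
  assumes "subst F ps = subst G ps" "\<And>z. z \<in> set ps \<Longrightarrow> length (F z) = length (G z)" "z \<in> set ps"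
  shows "F z = G z"
  using assms by (induction ps) (auto simp: append_eq_append_conv)

text \<open>A core \<open>Inl x\<close> with a neighbouring single letter; the flag will be
  \<open>k < i\<close>, since a column to the right of the pair follows the core and one to the left
  precedes it.\<close>

definition enc :: "bool \<Rightarrow> 'a \<times> 'b \<Rightarrow> ('a + 'b) list" where
  "enc t = (\<lambda>(x, a). if t then [Inl x, Inr a] else [Inr a, Inl x])"

lemma alternating_pairs:
  assumes "fusion (range Inr) (range Inl) w" "w \<noteq> []"
    "hd w \<in> range Inl \<longleftrightarrow> t" "last w \<in> range Inr \<longleftrightarrow> t"
  shows "\<exists>ps. w = subst (enc t) ps"
  using assms
proof (induction w rule: induct_list012)
  case (2 p)
  then show ?case by (cases p) auto
next
  case (3 p q zs)
  have pq: "enc t (x, a) = [p, q]" if "t \<Longrightarrow> p = Inl x \<and> q = Inr a" "\<not> t \<Longrightarrow> p = Inr a \<and> q = Inl x" for x a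
    using that by (auto simp: enc_def)
  have 1: "\<exists>x a. enc t (x, a) = [p, q]"
    using 3(3,5) by (cases p; cases q) (auto simp: fusion_def enc_def split: if_splits)
  then obtain z where z: "enc t z = [p, q]" by blast
  show ?case
  proof (cases zs)
    case Nil
    then have "p # q # zs = subst (enc t) [z]" using z by simp
    then show ?thesis by blast
  next
    case (Cons q' zs')
    have "fusion (range Inr) (range Inl) zs" using 3(3) Cons by (auto simp: fusion_def)
    moreover have "hd zs \<in> range Inl \<longleftrightarrow> t"
      using 3(3,5) Cons by (cases p; cases q; cases q') (auto simp: fusion_def)
    ultimately obtain ps where "zs = subst (enc t) ps"
      using 3(1) 3(6) Cons by auto
    then have "p # q # zs = subst (enc t) (z # ps)" using z by simp
    then show ?thesis by blast
  qed
qed simp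

lemma inj_Suc_mod: "a < r \<Longrightarrow> b < r \<Longrightarrow> Suc a mod r = Suc b mod r \<longleftrightarrow> a = b"
  by (auto simp: mod_Suc)

section \<open>Deletion of short columns\<close>

context block_factorization
begin

text \<open>Columns are rotated so that column \<open>k + 2\<close> comes to position
  \<open>0\<close>. A short letter then climbs by one, while a core falls from \<open>r - 2\<close>
  to \<open>0\<close>; so no letter that is to be deleted wraps around.\<close>

definition step_start :: "nat + letter \<Rightarrow> nat" where
  "step_start p = (first_col p + (r - (k + 2))) mod r"

definition step_end :: "nat + letter \<Rightarrow> nat" where
  "step_end p = (Suc (last_col p) + (r - (k + 2))) mod r"

lemma step_short:
  assumes "p \<in> shorts ({..<r} - {k, Suc k})"
  shows "step_start p < step_end p" "step_end p < r"
proof -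
  obtain c b where c: "p = Inr (c, b)" "c < r" "c \<noteq> k" "c \<noteq> Suc k" using assms by auto
  have "step_start p < step_end p"
  proof (cases "c < k")
    case True
    then have "c + (r - (k + 2)) < r" "Suc c + (r - (k + 2)) < r" using k by auto
    then show ?thesis by (simp add: step_start_def step_end_def c(1))
  next
    case False
    then have e: "c + (r - (k + 2)) = r + (c - (k + 2))" "Suc c + (r - (k + 2)) = r + (Suc c - (k + 2))"
      using k c by auto
    have "c - (k + 2) < r" "Suc c - (k + 2) < r" "c - (k + 2) < Suc c - (k + 2)" using c False by auto
    then show ?thesis
      unfolding step_start_def step_end_def c(1) first_col.simps last_col.simps fst_conv e
      by (simp only: mod_add_self1 mod_less)
  qed
  then show "step_start p < step_end p" "step_end p < r"
    using k by (auto simp: step_end_def)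
qed

lemma linked_pieces: "successively (\<lambda>p q. step_end p = step_start q) (subst pieces u)"
  using adjacent_pieces
proof (rule successively_mono)
  fix p q assume "first_col q = Suc (last_col p) mod r"
  then show "step_end p = step_start q"
    by (simp only: step_start_def step_end_def mod_add_left_eq)
qed

text \<open>The set of deleted columns is arbitrary on purpose: deleting all of them yields the word
  one level down, deleting all but one exposes that column in \<open>v\<close>.\<close>

lemma
  assumes "I \<subseteq> {..<r} - {k, Suc k}"
  shows fits_insert_shorts: "fits (without (shorts I) (subst pieces u)) \<Longrightarrow> fits (subst pieces u)"
    and rigid_delete_shorts: "rigid u v \<Longrightarrow> rigid (without (shorts I) (subst pieces u)) (without (shorts I) (subst pieces v))"
proof -
  have "p \<in> shorts ({..<r} - {k, Suc k})" if "p \<in> shorts I" for p using that assms by blast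
  note s = step_short[OF this]
  show "fits (without (shorts I) (subst pieces u)) \<Longrightarrow> fits (subst pieces u)"
    by (rule fits_insert_all[OF linked_pieces, of "shorts I" r]) (use s in auto)
  assume "rigid u v"
  then have "rigid (subst pieces u) (subst pieces v)"
    by (rule rigid_subst[OF nonerasing_pieces])
  then show "rigid (without (shorts I) (subst pieces u)) (without (shorts I) (subst pieces v))"
    by (rule rigid_delete_all[OF linked_pieces, rotated -1]) (use s in auto)
qed

lemma subst_case_sum: "subst (case_sum (\<lambda>x. [x]) (\<lambda>_. [0])) (map Inl v) = v"
  by (induction v) auto

lemma fits_Inl: "fits v \<Longrightarrow> fits (map Inl v :: (nat + letter) list)"
  by (rule fits_subst[of "case_sum (\<lambda>x. [x]) (\<lambda>_. [0])"]) (simp_all only: subst_case_sum, simp split: sum.split)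

lemma rigid_Inl: "rigid (map Inl v :: (nat + letter) list) (map Inl w) \<Longrightarrow> rigid v w"
  using rigid_subst[of "case_sum (\<lambda>x. [x]) (\<lambda>_. [0])" "map Inl v :: (nat + letter) list" "map Inl w", unfolded subst_case_sum]
  by (auto split: sum.split)

lemma fits_pieces: "fits (filter long u) \<Longrightarrow> fits (subst pieces u)"
  using fits_insert_shorts[OF order_refl] without_shorts[OF subset_refl] fits_Inl by simp

lemma fits_step: "fits (filter long u) \<Longrightarrow> fits u"
  using fits_subst[OF nonerasing_pieces] fits_pieces by blast

lemma rigid_step:
  assumes "set v \<subseteq> set u" "rigid u v"
  shows "rigid (filter long u) (filter long v)"
  using rigid_delete_shorts[OF order_refl assms(2)] without_shorts[OF subset_refl] without_shorts[OF assms(1)]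
  by (simp add: rigid_Inl)

lemma filter_val_without:
  assumes "\<And>a. fst a \<in> I \<Longrightarrow> \<not> P a"
  shows "filter P (subst val ps) = subst (\<lambda>p. filter P (val p)) (without (shorts I) ps)"
  using assms by (induction ps) auto

section \<open>Recovery of a single short column\<close>

context
  fixes i :: nat
  assumes i: "i < r" "i \<noteq> k" "i \<noteq> Suc k"
begin

definition column_pieces :: "nat list \<Rightarrow> (nat + letter) list" where
  "column_pieces v = without (shorts ({..<r} - {k, Suc k, i})) (subst pieces v)"

lemma set_column_pieces:
  assumes "set v \<subseteq> set u" "p \<in> set (column_pieces v)"
  shows "(\<exists>x. p = Inl x \<and> x \<in> set v \<and> long x) \<or> (\<exists>a. p = Inr a \<and> fst a = i)"
  using val_cols(4)[OF assms(1), of p] assms(2) by (auto simp: column_pieces_def)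

lemma column_pieces_longs:
  assumes "set v \<subseteq> set u"
  shows "without (range Inr) (column_pieces v) = map Inl (filter long v)"
proof -
  have "without (range Inr) (column_pieces v) =
        filter (\<lambda>p. p \<notin> range Inr \<and> p \<notin> shorts ({..<r} - {k, Suc k, i})) (subst pieces v)"
    unfolding column_pieces_def filter_filter by (rule filter_cong) auto
  also have "\<dots> = without (shorts ({..<r} - {k, Suc k})) (subst pieces v)"
    using val_cols(4)[OF assms] by (intro filter_cong) auto
  finally show ?thesis using without_shorts[OF assms] by simp
qed

definition three :: "letter \<Rightarrow> bool" where
  "three a \<longleftrightarrow> fst a \<in> {k, Suc k, i}"

lemma filter_three_block:
  "filter three (block r b) = (if k < i then [entry k b, entry (Suc k) b, entry i b] else [entry i b, entry k b, entry (Suc k) b])"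
proof -
  have "[0..<r] = [0..<k] @ k # Suc k # [Suc (Suc k)..<r]"
    using k upt_add_eq_append[of 0 k "r - k"] by (simp add: upt_conv_Cons)
  moreover have "filter (\<lambda>j. j \<in> {k, Suc k, i}) [0..<k] = filter (\<lambda>j. j = i) [0..<k]"
    by (rule filter_cong) auto
  moreover have "filter (\<lambda>j. j \<in> {k, Suc k, i}) [Suc (Suc k)..<r] = filter (\<lambda>j. j = i) [Suc (Suc k)..<r]"
    by (rule filter_cong) auto
  ultimately have "filter (\<lambda>j. j \<in> {k, Suc k, i}) [0..<r] = (if k < i then [k, Suc k, i] else [i, k, Suc k])"
    using i unfolding filter_eq_upt by (auto simp: filter_eq_upt)
  then show ?thesis
    by (simp add: block_def filter_map o_def three_def)
qed

lemma three_blocks: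
  "successively (\<lambda>a b. (fst a, fst b) \<in> {(k, Suc k), (Suc k, i), (i, k)}) (subst (\<lambda>b. filter three (block r b)) B)"
proof (subst successively_subst)
  show "\<forall>x\<in>set B. filter three (block r x) \<noteq> []" by (simp add: filter_three_block)
  show "(\<forall>x\<in>set B. successively (\<lambda>a b. (fst a, fst b) \<in> {(k, Suc k), (Suc k, i), (i, k)}) (filter three (block r x))) \<and>
    successively (\<lambda>x y. (fst (last (filter three (block r x))), fst (hd (filter three (block r y)))) \<in> {(k, Suc k), (Suc k, i), (i, k)}) B"
    by (auto simp: filter_three_block) (auto simp: successively_conv_nth)
qed

lemma val_three:
  assumes "set v \<subseteq> set u" "p \<in> set (column_pieces v)"
  shows "filter three (val p) \<noteq> []" "fst (hd (filter three (val p))) = first_col p" "fst (last (filter three (val p))) = last_col p"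
proof -
  have p: "p \<in> set (subst pieces v)" using assms(2) by (simp add: column_pieces_def)
  note c = val_cols[OF assms(1) p]
  have t: "three (hd (val p))" "three (last (val p))"
    using set_column_pieces[OF assms] c(2,3) by (auto simp: three_def)
  show "filter three (val p) \<noteq> []" using t(1) c(1) by (auto simp: filter_empty_conv intro!: bexI[of _ "hd (val p)"])
  show "fst (hd (filter three (val p))) = first_col p" "fst (last (filter three (val p))) = last_col p"
    using hd_filter[of "val p" three] last_filter[of "val p" three] t c(1-3) by auto
qed

lemma subst_three: "subst (\<lambda>p. filter three (val p)) (column_pieces u) = subst (\<lambda>b. filter three (block r b)) B"
proof -
  have "subst (\<lambda>p. filter three (val p)) (column_pieces u) = filter three (subst val (subst pieces u))"
    unfolding column_pieces_def by (rule filter_val_without[symmetric]) (auto simp: three_def)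
  also have "\<dots> = subst (\<lambda>b. filter three (block r b)) B"
    unfolding subst_val \<theta>u by (simp add: filter_concat o_def)
  finally show ?thesis .
qed

lemma column_pieces_neq_Nil: "column_pieces u \<noteq> []"
proof
  assume "column_pieces u = []"
  then have "subst (\<lambda>b. filter three (block r b)) B = []" using subst_three by simp
  then show False using B by (cases B) (simp_all add: filter_three_block split: if_splits)
qed

text \<open>Restricted to the columns \<open>k\<close>, \<open>k + 1\<close> and \<open>i\<close>, a
  product of blocks has period three in its columns. A core enters at \<open>k\<close> and leaves at
  \<open>k + 1\<close>, so what follows it is a letter of column \<open>i\<close>, and
  conversely.\<close>

lemma column_fusion: "fusion (range Inr) (range Inl) (column_pieces u)"
proof -
  have "successively (\<lambda>p q. (fst (last (filter three (val p))), fst (hd (filter three (val q)))) \<in> {(k, Suc k), (Suc k, i), (i, k)}) (column_pieces u)"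
    using three_blocks unfolding subst_three[symmetric]
    by (subst (asm) successively_subst) (use val_three(1)[OF subset_refl] in auto)
  then show ?thesis
    unfolding fusion_def
  proof (rule successively_cong[THEN iffD1, rotated -1])
    fix p q assume pq: "p \<in> set (column_pieces u)" "q \<in> set (column_pieces u)"
    show "((fst (last (filter three (val p))), fst (hd (filter three (val q)))) \<in> {(k, Suc k), (Suc k, i), (i, k)}) =
      ((p \<in> range Inr) = (q \<in> range Inl))"
      using set_column_pieces[OF subset_refl pq(1)] set_column_pieces[OF subset_refl pq(2)] i
      unfolding val_three(2)[OF subset_refl pq(2)] val_three(3)[OF subset_refl pq(1)] by auto
  qed (rule refl)
qed

lemma column_ends:
  "hd (column_pieces u) \<in> range Inl \<longleftrightarrow> k < i" "last (column_pieces u) \<in> range Inr \<longleftrightarrow> k < i"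
proof -
  let ?w = "column_pieces u"
  have s: "hd ?w \<in> set ?w" "last ?w \<in> set ?w" using column_pieces_neq_Nil by simp_all
  note n = val_three(1)[OF subset_refl]
  have "fst (hd (subst (\<lambda>p. filter three (val p)) ?w)) = first_col (hd ?w)"
    using val_three(1,2)[OF subset_refl s(1)] column_pieces_neq_Nil by (cases ?w) auto
  moreover have "fst (last (subst (\<lambda>p. filter three (val p)) ?w)) = last_col (last ?w)"
    using val_three(1,3)[OF subset_refl s(2)] column_pieces_neq_Nil by (cases ?w rule: rev_cases) auto
  moreover have "fst (hd (subst (\<lambda>b. filter three (block r b)) B)) = (if k < i then k else i)"
    using B by (cases B) (auto simp: filter_three_block)
  moreover have "fst (last (subst (\<lambda>b. filter three (block r b)) B)) = (if k < i then i else Suc k)"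
    using B by (cases B rule: rev_cases) (auto simp: filter_three_block)
  ultimately have "first_col (hd ?w) = (if k < i then k else i)" "last_col (last ?w) = (if k < i then i else Suc k)"
    unfolding subst_three by simp_all
  then show "hd ?w \<in> range Inl \<longleftrightarrow> k < i" "last ?w \<in> range Inr \<longleftrightarrow> k < i"
    using set_column_pieces[OF subset_refl s(1)] set_column_pieces[OF subset_refl s(2)] i
    by (auto split: if_splits)
qed

text \<open>A core misses the column \<open>i\<close> letter of just one of its blocks: the last
  block if \<open>i\<close> lies to the right of the pair, the first one otherwise.\<close>

definition partner :: "nat \<Rightarrow> letter" where
  "partner x = entry i (if k < i then last (\<psi> x) else hd (\<psi> x))"

definition column :: "letter list \<Rightarrow> letter list" where
  "column w = filter (\<lambda>a. fst a = i) w"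

lemma column_core:
  assumes "x \<in> set u" "long x"
  shows "subst (\<lambda>p. column (val p)) (enc (k < i) (x, partner x)) = map (entry i) (\<psi> x)"
  using filter_core[OF k core_sublist[OF assms(1)] core_props[OF assms] i(1)] psi_core[OF assms] i
  by (auto simp: enc_def partner_def column_def)

lemma column_val:
  "column (subst \<theta> v) = subst (\<lambda>p. column (val p)) (column_pieces v)"
  unfolding subst_val[symmetric] column_pieces_def column_def by (rule filter_val_without) auto

lemma enc_longs: "without (range Inr) (subst (enc t) ps) = map Inl (map fst ps)"
  by (induction ps) (auto simp: enc_def)

lemma enc_set: "(x, a) \<in> set ps \<Longrightarrow> Inl x \<in> set (subst (enc t) ps) \<and> Inr a \<in> set (subst (enc t) ps)"
  by (induction ps) (auto simp: enc_def)

text \<open>Grouped by pairs, column \<open>i\<close> of the image of \<open>u\<close> has to spell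
  \<open>map (entry i) B\<close>. The groups have the expected lengths, so they agree one by one and
  leave no choice for the letter beside each core.\<close>

lemma column_u:
  obtains ps where "column_pieces u = subst (enc (k < i)) ps" "\<And>x a. (x, a) \<in> set ps \<Longrightarrow> a = partner x"
proof -
  obtain ps where ps: "column_pieces u = subst (enc (k < i)) ps"
    using alternating_pairs[OF column_fusion column_pieces_neq_Nil column_ends] by blast
  have l: "map fst ps = filter long u"
    using column_pieces_longs[OF subset_refl] unfolding ps enc_longs by (simp only: inj_map_eq_map[OF inj_Inl])
  have x: "x \<in> set u \<and> long x \<and> fst a = i" if "(x, a) \<in> set ps" for x a
    using enc_set[OF that] set_column_pieces[OF subset_refl] unfolding ps by blast
  let ?F = "\<lambda>z. subst (\<lambda>p. column (val p)) (enc (k < i) z)"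
  let ?G = "\<lambda>z. map (entry i) (\<psi> (fst z))"
  have "subst ?F ps = column (subst \<theta> u)"
    unfolding column_val ps concat_map_subst ..
  also have "\<dots> = map (entry i) B"
    unfolding \<theta>u column_def by (rule filter_blocks[OF i(1)])
  also have "\<dots> = map (entry i) (subst \<psi> (map fst ps))"
    unfolding l subst_psi_long subst_psi_u ..
  also have "\<dots> = subst ?G ps" by (simp add: map_concat o_def)
  finally have FG: "subst ?F ps = subst ?G ps" .
  have len: "length (?F z) = length (?G z)" if "z \<in> set ps" for z
  proof -
    obtain y a where z: "z = (y, a)" by (cases z)
    have "length (?F (y, a)) = length (?F (y, partner y))"
      using x[of y a] that z by (simp add: enc_def column_def partner_def)
    then show ?thesis
      using column_core[of y] x[of y a] that z by simp
  qed
  have "a = partner y" if "(y, a) \<in> set ps" for y a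
  proof -
    have "?F (y, a) = ?F (y, partner y)"
      using subst_eqD[OF FG len that] column_core[of y] x[OF that] by simp
    then show ?thesis
      using x[OF that] by (auto simp: enc_def column_def partner_def split: if_splits)
  qed
  then show thesis using that ps by blast
qed

lemma column_v:
  assumes v: "set v \<subseteq> set u" and r: "rigid u v" and f: "fits (filter long u)"
    and \<psi>v: "subst \<psi> (filter long v) = B"
  shows "column (subst \<theta> v) = map (entry i) B"
proof -
  \<comment> \<open>As cores and column letters alternate, one fusion inserts all column letters at
    once.\<close>
  have f': "fits (column_pieces u)"
    by (rule fits_insert[OF column_fusion, of "range Inr"]) (auto simp: column_pieces_longs fits_Inl f)
  have r': "rigid (column_pieces u) (column_pieces v)"
    unfolding column_pieces_def by (rule rigid_delete_shorts[OF _ r]) auto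
  note rf = rigid_fusion[OF f' r' _ column_pieces_neq_Nil]
  obtain ps where ps: "column_pieces u = subst (enc (k < i)) ps" "\<And>x a. (x, a) \<in> set ps \<Longrightarrow> a = partner x"
    using column_u by blast
  obtain qs where qs: "column_pieces v = subst (enc (k < i)) qs"
    using alternating_pairs[OF rf(1,2)[OF column_fusion], of "k < i"] rf(3,4)[OF column_fusion] column_ends by blast
  have l: "map fst qs = filter long v"
    using column_pieces_longs[OF v] unfolding qs enc_longs by (simp only: inj_map_eq_map[OF inj_Inl])
  have enc_neq: "\<forall>z\<in>set ps. enc (k < i) z \<noteq> []" "\<forall>z\<in>set qs. enc (k < i) z \<noteq> []"
    by (simp_all add: enc_def split: prod.split)
  have q: "a = partner x" if xa: "(x, a) \<in> set qs" for x a
  proof -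
    let ?X = "Inl ` {x. partner x = a}"
    \<comment> \<open>In \<open>u\<close> the letter \<open>a\<close> is paired with precisely those
      cores whose partner it is. For fixed \<open>a\<close> this is a fusion, oriented by which
      component of a pair comes first, so it passes to \<open>v\<close>.\<close>
    define B' C' where "B' = (if k < i then ?X else {Inr a})" and "C' = (if k < i then {Inr a} else ?X)"
    have "fusion B' C' (column_pieces u)"
      unfolding fusion_def ps(1) successively_subst[OF enc_neq(1)]
    proof
      show "\<forall>z\<in>set ps. successively (\<lambda>x y. (x \<in> B') = (y \<in> C')) (enc (k < i) z)"
        using ps(2) by (auto simp: enc_def B'_def C'_def)
      show "successively (\<lambda>x y. (last (enc (k < i) x) \<in> B') = (hd (enc (k < i) y) \<in> C')) ps"
        by (auto simp: successively_conv_nth enc_def B'_def C'_def split: prod.splits)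
    qed
    then have "fusion B' C' (column_pieces v)" by (rule rf(1))
    then have "successively (\<lambda>x y. (x \<in> B') = (y \<in> C')) (enc (k < i) (x, a))"
      unfolding fusion_def qs successively_subst[OF enc_neq(2)] using xa by blast
    then show "a = partner x"
      by (auto simp: enc_def B'_def C'_def split: if_splits)
  qed
  have x: "x \<in> set u \<and> long x" if "(x, a) \<in> set qs" for x a
    using enc_set[OF that] set_column_pieces[OF v] v unfolding qs by blast
  have "column (subst \<theta> v) = subst (\<lambda>z. subst (\<lambda>p. column (val p)) (enc (k < i) z)) qs"
    unfolding column_val qs concat_map_subst ..
  also have "\<dots> = subst (\<lambda>z. map (entry i) (\<psi> (fst z))) qs"
  proof (rule subst_cong)
    fix z assume zs: "z \<in> set qs"
    obtain y a where z: "z = (y, a)" by (cases z)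
    show "subst (\<lambda>p. column (val p)) (enc (k < i) z) = map (entry i) (\<psi> (fst z))"
      using column_core[of y] q[of y a] x[of y a] zs unfolding z by simp
  qed
  also have "\<dots> = map (entry i) (subst \<psi> (map fst qs))" by (simp add: map_concat o_def)
  also have "\<dots> = map (entry i) B" unfolding l \<psi>v ..
  finally show ?thesis .
qed

end

lemma core_column_v:
  assumes "set v \<subseteq> set u" "subst \<psi> (filter long v) = B" "i = k \<or> i = Suc k"
  shows "filter (\<lambda>a. fst a = i) (subst \<theta> v) = map (entry i) B"
proof -
  have "filter (\<lambda>a. fst a = i) (subst \<theta> v) =
        subst (\<lambda>p. filter (\<lambda>a. fst a = i) (val p)) (without (shorts ({..<r} - {k, Suc k})) (subst pieces v))"
    unfolding subst_val[symmetric] by (rule filter_val_without) (use assms(3) in auto)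
  also have "\<dots> = subst (\<lambda>x. filter (\<lambda>a. fst a = i) (core x)) (filter long v)"
    unfolding without_shorts[OF assms(1)] by (simp add: o_def)
  also have "\<dots> = subst (\<lambda>x. map (entry i) (\<psi> x)) (filter long v)"
  proof (rule subst_cong)
    fix x assume "x \<in> set (filter long v)"
    then have x: "x \<in> set u" "long x" using assms(1) by auto
    show "filter (\<lambda>a. fst a = i) (core x) = map (entry i) (\<psi> x)"
      using filter_core[OF k core_sublist[OF x(1)] core_props[OF x], of i] psi_core[OF x] assms(3) k by auto
  qed
  also have "\<dots> = map (entry i) B"
    unfolding assms(2)[symmetric] by (simp add: map_concat o_def)
  finally show ?thesis .
qed

text \<open>For each column \<open>t\<close>, the pieces ending in \<open>t\<close> and the pieces
  starting in the column after \<open>t\<close> form a fusion of the pieces of \<open>u\<close>.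
  Transferred to \<open>v\<close> for all \<open>t\<close>, these say that columns advance
  cyclically; the case \<open>t = r - 1\<close> also fixes the first column.\<close>

lemma cyclic_v:
  assumes v: "set v \<subseteq> set u" and r: "rigid u v" and f: "fits (filter long u)"
  shows "cyclic r (subst \<theta> v)" "fst (hd (subst \<theta> v)) = 0"
proof -
  have f': "fits (subst pieces u)" by (rule fits_pieces[OF f])
  have r': "rigid (subst pieces u) (subst pieces v)" by (rule rigid_subst[OF nonerasing_pieces r])
  have ne: "subst pieces u \<noteq> []" using subst_neq_Nil[OF nonerasing_pieces u] .
  define B' C' where "B' t = {p. last_col p = t}" and "C' t = {p. first_col p = Suc t mod r}" for t
  have lc: "last_col p < r" if "p \<in> set (subst pieces v)" "set v \<subseteq> set u" for p v
    using val_cols(4)[OF that(2,1)] k by auto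
  have fu: "fusion (B' t) (C' t) (subst pieces u)" if "t < r" for t
    using adjacent_pieces unfolding fusion_def
  proof (rule successively_mono_set)
    fix p q assume "p \<in> set (subst pieces u)" "first_col q = Suc (last_col p) mod r"
    then show "p \<in> B' t \<longleftrightarrow> q \<in> C' t"
      using inj_Suc_mod[OF lc[OF _ subset_refl] that] by (simp add: B'_def C'_def)
  qed
  note rf = rigid_fusion[OF f' r' fu ne]
  have adj: "successively (\<lambda>p q. first_col q = Suc (last_col p) mod r) (subst pieces v)"
    unfolding successively_conv_nth
  proof (intro allI impI)
    fix j assume j: "Suc j < length (subst pieces v)"
    let ?p = "subst pieces v ! j" and ?q = "subst pieces v ! Suc j"
    have "last_col ?p < r" using j by (intro lc[OF _ v]) (simp add: nth_mem del: set_concat)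
    from rf(1)[OF this] j show "first_col ?q = Suc (last_col ?p) mod r"
      by (auto simp: fusion_def successively_conv_nth B'_def C'_def)
  qed
  have "cyclic r (subst val (subst pieces v))"
    unfolding cyclic_def
  proof (subst successively_subst)
    show "\<forall>p\<in>set (subst pieces v). val p \<noteq> []" using val_cols(1)[OF v] by blast
    have "successively (\<lambda>a b. fst b = Suc (fst a) mod r) (val p)" if "p \<in> set (subst pieces v)" for p
    proof (cases p)
      case (Inl x)
      then have "x \<in> set u" using val_cols(4)[OF v that] v by auto
      then show ?thesis
        using Inl successively_sublist[OF _ core_sublist] cyclic_blocks[of r B] k unfolding cyclic_def by simp
    qed simp
    moreover have "successively (\<lambda>p q. fst (hd (val q)) = Suc (fst (last (val p))) mod r) (subst pieces v)"
      using adj by (rule successively_cong[THEN iffD1, rotated -1]) (use val_cols(2,3)[OF v] in auto)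
    ultimately show "(\<forall>p\<in>set (subst pieces v). successively (\<lambda>a b. fst b = Suc (fst a) mod r) (val p)) \<and>
      successively (\<lambda>p q. fst (hd (val q)) = Suc (fst (last (val p))) mod r) (subst pieces v)" by blast
  qed
  then show "cyclic r (subst \<theta> v)" unfolding subst_val .
  have r1: "r - 1 < r" using k by simp
  have "first_col (hd (subst pieces u)) = 0"
  proof -
    have "hd (subst pieces u) \<in> set (subst pieces u)" using ne by (rule hd_in_set)
    then have "first_col (hd (subst pieces u)) = fst (hd (val (hd (subst pieces u))))" "val (hd (subst pieces u)) \<noteq> []"
      using val_cols(1,2)[OF subset_refl] by auto
    moreover have "hd (subst val (subst pieces u)) = hd (val (hd (subst pieces u)))"
      using ne \<open>val (hd (subst pieces u)) \<noteq> []\<close> by (cases "subst pieces u") simp_all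
    ultimately show ?thesis
      using hd_theta hd_subst[OF nonerasing u] unfolding subst_val by simp
  qed
  then have "hd (subst pieces v) \<in> C' (r - 1)"
    using rf(3)[OF r1] k by (simp add: C'_def)
  then have h: "first_col (hd (subst pieces v)) = 0" using k by (simp add: C'_def)
  have nv: "subst pieces v \<noteq> []" using rf(2)[OF r1] .
  then have "hd (subst pieces v) \<in> set (subst pieces v)" by (rule hd_in_set)
  then have "fst (hd (val (hd (subst pieces v)))) = 0" "val (hd (subst pieces v)) \<noteq> []"
    using val_cols(1,2)[OF v] h by auto
  then show "fst (hd (subst \<theta> v)) = 0"
    using nv unfolding subst_val[symmetric] by (cases "subst pieces v") simp_all
qed

text \<open>The hypothesis one level down settles columns \<open>k\<close> and \<open>k + 1\<close>,
  which lie in the cores; \<open>column_v\<close> settles the others one by one, and cyclicity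
  reassembles them.\<close>

lemma value_step:
  assumes v: "set v \<subseteq> set u" and r: "rigid u v" and f: "fits (filter long u)"
    and \<psi>v: "subst \<psi> (filter long u) = subst \<psi> (filter long v)"
  shows "subst \<theta> u = subst \<theta> v"
proof -
  have \<psi>B: "subst \<psi> (filter long v) = B"
    using \<psi>v subst_psi_u by (simp add: subst_psi_long)
  have "subst (block r) B = subst \<theta> v"
  proof (rule cyclic_eqI)
    show "cyclic r (subst (block r) B)" by (rule cyclic_blocks) (use k in simp)
    show "cyclic r (subst \<theta> v)" by (rule cyclic_v[OF v r f])
    show "fst (hd (subst (block r) B)) = fst (hd (subst \<theta> v))"
      using hd_theta hd_subst[OF nonerasing u] unfolding cyclic_v(2)[OF v r f] \<theta>u[symmetric] by simp
    show "filter (\<lambda>a. fst a = i) (subst (block r) B) = filter (\<lambda>a. fst a = i) (subst \<theta> v)" for i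
    proof (cases "i < r")
      case True
      show ?thesis
      proof (cases "i = k \<or> i = Suc k")
        case False
        then have i: "i \<noteq> k" "i \<noteq> Suc k" by auto
        from column_v[OF True i v r f \<psi>B] show ?thesis
          unfolding filter_blocks[OF True] column_def[OF True i] by simp
      qed (simp only: filter_blocks[OF True] core_column_v[OF v \<psi>B])
    next
      case False
      then have "filter (\<lambda>a. fst a = i) (subst \<theta> v) = []"
        using theta_col v by (fastforce simp: filter_empty_conv)
      moreover have "filter (\<lambda>a. fst a = i) (subst (block r) B) = []"
        using False by (auto simp: filter_empty_conv set_block)
      ultimately show ?thesis by simp
    qed
  qed
  then show ?thesis unfolding \<theta>u .
qed

end

section \<open>Induction on the level of the block word\<close>

section \<open>Block words are isoterms\<close>

primrec block_word :: "nat \<Rightarrow> nat \<Rightarrow> letter list" where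
  "block_word r 0 = [(0, 0)]"
| "block_word r (Suc m) = subst (block r) (block_word r m)"

lemma sublist_bracket_cancel:
  assumes "a # w @ [b] = x @ y @ z" "x \<noteq> []" "z \<noteq> []"
  shows "sublist y w"
proof -
  obtain x' z' where "x = a # x'" "z = z' @ [b]"
    using assms by (cases x; cases z rule: rev_cases) auto
  then have "w = x' @ y @ z'" using assms(1) by simp
  then show ?thesis by simp
qed

text \<open>Passing one level down only removes letters, so the same \<open>n\<close> and hence the
  same alphabet serve all levels. The conjunct \<open>fits u\<close> has to be carried along because
  every transfer from \<open>u\<close> to \<open>v\<close> needs a substitution into a Zimin
  word.\<close>

lemma sublist_block_word:
  fixes u v :: "nat list"
  assumes "nonerasing \<theta>" "card (set u) \<le> n" "sublist (subst \<theta> u) (block_word (n + 3) m)"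
  shows "fits u \<and> (rigid u v \<longrightarrow> subst \<theta> u = subst \<theta> v)"
  using assms
proof (induction m arbitrary: u \<theta> v)
  case 0
  then have l: "length (subst \<theta> u) \<le> 1"
    using sublist_length_le[OF 0(3)] by simp
  have len: "length w \<le> length (subst \<theta> w)" for w
  proof (induction w)
    case (Cons x w)
    have "length (\<theta> x) > 0" using 0(1) by simp
    then show ?case using Cons by (simp del: length_greater_0_conv)
  qed simp
  have "length u \<le> 1" using len[of u] l by linarith
  then consider "u = []" | x where "u = [x]" by (cases u) auto
  then show ?case
  proof cases
    case 1
    have "fits u"
      by (rule fitsI[of "\<lambda>_. [0]" _ 0]) (simp_all add: 1)
    moreover have "subst \<theta> u = subst \<theta> v" if "rigid u v"
      using rigidD[OF that, of "\<lambda>_. [0]" 0] 1 by simp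
    ultimately show ?thesis by blast
  next
    case 2
    have s: "sublist (subst (\<lambda>_. [0]) u) (zimin 1)" by (simp add: 2)
    have f: "fits u"
      by (rule fitsI[OF _ s]) simp
    moreover have "subst \<theta> u = subst \<theta> v" if "rigid u v"
    proof -
      have "length v = 1" using arg_cong[OF rigidD[OF that _ s], of length] 2 by simp
      then obtain y where "v = [y]" by (metis One_nat_def length_0_conv length_Suc_conv)
      then show ?thesis using rigid_set_subset[OF f that] 2 by simp
    qed
    ultimately show ?thesis by blast
  qed
next
  case (Suc m)
  define r where "r = n + 3"
  obtain s t where st: "subst (block r) (block_word r m) = s @ subst \<theta> u @ t"
    using Suc.prems(3) by (auto simp: sublist_def r_def)
  obtain p where p: "p \<notin> set u \<union> set v" using ex_new_if_finite[OF infinite_UNIV_nat, of "set u \<union> set v"] by auto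
  obtain q where q: "q \<notin> insert p (set u \<union> set v)" using ex_new_if_finite[OF infinite_UNIV_nat, of "insert p (set u \<union> set v)"] by auto
  \<comment> \<open>The brackets complete the factor to whole blocks. The additional block
    \<open>(0, 0)\<close> at either end makes both brackets long, so one level down they remain and
    absorb the added blocks.\<close>
  define \<eta> where "\<eta> = \<theta>(p := block r (0, 0) @ s, q := t @ block r (0, 0))"
  define B where "B = (0, 0) # block_word r m @ [(0, 0)]"
  define u' v' where "u' = p # u @ [q]" and "v' = p # v @ [q]"
  have r0: "0 < r" by (simp add: r_def)
  have \<eta>: "subst \<eta> u = subst \<theta> u" "subst \<eta> v = subst \<theta> v"
    using p q by (auto intro!: subst_cong simp: \<eta>_def)
  have \<eta>pq: "\<eta> p = block r (0, 0) @ s" "\<eta> q = t @ block r (0, 0)"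
    using q by (auto simp: \<eta>_def)
  have eq: "subst \<eta> u' = subst (block r) B"
    using st by (simp add: u'_def B_def \<eta> \<eta>pq)
  \<comment> \<open>The letter \<open>p\<close> starts in column \<open>0\<close>, and at most
    \<open>n + 1\<close> other letters compete for the \<open>n + 2\<close> columns from
    \<open>1\<close> to \<open>r - 1\<close>. This is the origin of
    \<open>r = n + 3\<close>.\<close>
  have "\<exists>c\<in>{1..<r}. c \<notin> (\<lambda>x. fst (hd (\<eta> x))) ` (insert q (set u))"
  proof (rule ccontr)
    assume "\<not> ?thesis"
    then have "{1..<r} \<subseteq> (\<lambda>x. fst (hd (\<eta> x))) ` (insert q (set u))" by blast
    then have "card {1..<r} \<le> card ((\<lambda>x. fst (hd (\<eta> x))) ` (insert q (set u)))"
      by (intro card_mono) auto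
    also have "\<dots> \<le> card (insert q (set u))" by (rule card_image_le) simp
    also have "\<dots> \<le> Suc n" using Suc.prems(2) by (simp add: card_insert_if)
    finally show False by (simp add: r_def)
  qed
  then obtain k where k: "Suc k < r" "Suc k \<notin> (\<lambda>x. fst (hd (\<eta> x))) ` (insert q (set u))"
  proof (elim bexE)
    fix c assume "c \<in> {1..<r}" "c \<notin> (\<lambda>x. fst (hd (\<eta> x))) ` (insert q (set u))"
    then show thesis using that[of "c - 1"] by simp
  qed
  have hp: "fst (hd (\<eta> p)) = 0"
    using block_neq_Nil[OF r0] by (simp add: \<eta>pq hd_block[OF r0])
  interpret block_factorization r k \<eta> u' B
  proof
    show "Suc k < r" by (rule k)
    show "nonerasing \<eta>" using Suc.prems(1) block_neq_Nil[OF r0] by (simp add: \<eta>_def)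
    show "u' \<noteq> []" by (simp add: u'_def)
    show "subst \<eta> u' = subst (block r) B" by (rule eq)
    fix x assume "x \<in> set u'"
    then have "x = p \<or> x \<in> insert q (set u)" by (auto simp: u'_def)
    then show "fst (hd (\<eta> x)) \<noteq> Suc k"
    proof
      assume "x \<in> insert q (set u)"
      from imageI[OF this, of "\<lambda>x. fst (hd (\<eta> x))"] show ?thesis using k(2) by (intro notI) (simp only:)
    qed (use hp in simp)
  qed
  have "k \<in> fst ` set (block r (0, 0))" using k(1) by (simp add: set_block image_image)
  then have long_pq: "long p" "long q"
    unfolding long_def \<eta>pq set_append image_Un by (simp_all only: Un_iff simp_thms)
  let ?u = "filter long u" and ?v = "filter long v"
  have fl: "filter long u' = p # ?u @ [q]" "filter long v' = p # ?v @ [q]"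
    using long_pq by (simp_all add: u'_def v'_def)
  \<comment> \<open>The induction hypothesis requires a nonerasing substitution, but
    \<open>\<psi>\<close> erases letters that are not long. The default is harmless because only
    long letters are evaluated.\<close>
  define \<psi>' where "\<psi>' x = (if \<psi> x = [] then [(0, 0)] else \<psi> x)" for x
  have \<psi>': "subst \<psi>' (filter long w) = subst \<psi> (filter long w)" if "set w \<subseteq> set u'" for w
  proof (rule subst_cong)
    fix x assume "x \<in> set (filter long w)"
    then have "\<psi> x \<noteq> []" using that psi_neq_Nil[of x] by auto
    then show "\<psi>' x = \<psi> x" by (simp add: \<psi>'_def)
  qed
  have uu': "set u \<subseteq> set u'" by (auto simp: u'_def)
  have "subst \<psi> (p # ?u @ [q]) = (0, 0) # block_word r m @ [(0, 0)]"
    using subst_psi_u subst_psi_long[of u'] by (simp only: fl B_def)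
  then have "sublist (subst \<psi> ?u) (block_word r m)"
    using psi_neq_Nil[of p] psi_neq_Nil[of q] long_pq
    by (intro sublist_bracket_cancel[of "(0, 0)" _ "(0, 0)" "\<psi> p" _ "\<psi> q"]) (simp_all add: u'_def)
  then have s': "sublist (subst \<psi>' ?u) (block_word (n + 3) m)"
    using \<psi>'[OF uu'] by (simp add: r_def)
  have c: "card (set ?u) \<le> n"
    by (rule order_trans[OF card_mono Suc.prems(2)]) auto
  have ne': "nonerasing \<psi>'" by (simp add: \<psi>'_def)
  note IH = Suc.IH[OF ne' c s']
  have f: "fits (filter long u')"
    unfolding fl using IH p q by (intro fits_brackets) auto
  have fu': "fits u'" by (rule fits_step[OF f])
  have "sublist u u'" using sublist_appendI[of u "[p]" "[q]"] by (simp add: u'_def)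
  then have "fits u" by (rule fits_sublist[OF fu'])
  moreover have "subst \<theta> u = subst \<theta> v" if "rigid u v"
  proof -
    have r': "rigid u' v'"
      using rigid_context[OF that, of "[p]" "[q]"] by (simp add: u'_def v'_def)
    have v': "set v' \<subseteq> set u'" by (rule rigid_set_subset[OF fu' r'])
    have vu: "set v \<subseteq> set u'" using v' by (auto simp: v'_def)
    have "rigid (p # ?u @ [q]) (p # ?v @ [q])"
      using rigid_step[OF v' r'] unfolding fl .
    then have "rigid ?u ?v"
      by (rule rigid_brackets) (use p q in auto)
    then have "subst \<psi>' ?u = subst \<psi>' ?v" using IH by blast
    then have "subst \<psi> (filter long u') = subst \<psi> (filter long v')"
      using \<psi>'[OF uu'] \<psi>'[OF vu] unfolding fl by simp
    from value_step[OF v' r' f this] show ?thesis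
      by (simp add: u'_def v'_def \<eta>)
  qed
  ultimately show ?case by blast
qed

lemma length_block_word: "length (block_word r m) = r ^ m"
proof (induction m)
  case (Suc m)
  have "length (subst (block r) w) = r * length w" for w by (induction w) auto
  then show ?case using Suc by simp
qed simp

lemma block_word_letters: "0 < r \<Longrightarrow> set (block_word r m) \<subseteq> {..<r} \<times> {..<r}"
proof (induction m)
  case (Suc m)
  have "set (block r b) \<subseteq> {..<r} \<times> {..<r}" if "b \<in> {..<r} \<times> {..<r}" for b
    using that by (auto simp: set_block entry_def)
  then show ?case using Suc by auto
qed simp

section \<open>From isoterms to an infinite finitely generated model\<close>

section \<open>Sapir's criterion\<close>

lemma free_semigroup_morphism_iff:
  "semigroup_morphism free_semigroup S \<phi> \<longleftrightarrow>
   (\<forall>x. x \<noteq> [] \<longrightarrow> \<phi> x \<in> carrier S) \<and> (\<forall>x y. x \<noteq> [] \<longrightarrow> y \<noteq> [] \<longrightarrow> \<phi> (x @ y) = \<phi> x \<cdot>\<^bsub>S\<^esub> \<phi> y)"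
  by (auto simp: semigroup_morphism_def free_semigroup_def)

lemma is_semigroupD:
  assumes "is_semigroup S"
  shows "x \<in> carrier S \<Longrightarrow> y \<in> carrier S \<Longrightarrow> x \<cdot>\<^bsub>S\<^esub> y \<in> carrier S"
    and "x \<in> carrier S \<Longrightarrow> y \<in> carrier S \<Longrightarrow> z \<in> carrier S \<Longrightarrow> (x \<cdot>\<^bsub>S\<^esub> y) \<cdot>\<^bsub>S\<^esub> z = x \<cdot>\<^bsub>S\<^esub> (y \<cdot>\<^bsub>S\<^esub> z)"
  using assms by (auto simp: is_semigroup_def)

fun word_value :: "'a sgrp \<Rightarrow> (nat \<Rightarrow> 'a) \<Rightarrow> nat list \<Rightarrow> 'a" where
  "word_value S \<rho> (x # w) = (if w = [] then \<rho> x else \<rho> x \<cdot>\<^bsub>S\<^esub> word_value S \<rho> w)"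
| "word_value S \<rho> [] = undefined"

lemma word_value_closed:
  assumes "is_semigroup S" "\<And>x. x \<in> set w \<Longrightarrow> \<rho> x \<in> carrier S" "w \<noteq> []"
  shows "word_value S \<rho> w \<in> carrier S"
  using assms(2,3) by (induction w) (auto simp: is_semigroupD(1)[OF assms(1)])

lemma word_value_append:
  assumes "is_semigroup S" "\<And>x. x \<in> set v \<union> set w \<Longrightarrow> \<rho> x \<in> carrier S" "v \<noteq> []" "w \<noteq> []"
  shows "word_value S \<rho> (v @ w) = word_value S \<rho> v \<cdot>\<^bsub>S\<^esub> word_value S \<rho> w"
  using assms(2,3)
proof (induction v)
  case (Cons x v)
  have "word_value S \<rho> w \<in> carrier S"
    using Cons.prems by (intro word_value_closed[OF assms(1) _ assms(4)]) auto
  moreover have "v \<noteq> [] \<Longrightarrow> word_value S \<rho> v \<in> carrier S"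
    using Cons.prems by (intro word_value_closed[OF assms(1)]) auto
  ultimately show ?case
    using Cons assms(4) by (auto simp: is_semigroupD(2)[OF assms(1)])
qed simp

lemma word_value_morphism:
  assumes "is_semigroup S" "\<And>x. \<rho> x \<in> carrier S"
  shows "semigroup_morphism free_semigroup S (word_value S \<rho>)"
  unfolding free_semigroup_morphism_iff
  using word_value_closed[OF assms(1)] word_value_append[OF assms(1)] assms(2) by blast

lemma morphism_word_value:
  assumes "semigroup_morphism free_semigroup S \<phi>" "w \<noteq> []"
  shows "\<phi> w = word_value S (\<lambda>x. \<phi> [x]) w"
  using assms(2)
proof (induction w)
  case (Cons x w)
  then show ?case
    using assms(1) unfolding free_semigroup_morphism_iff
    by (cases "w = []") (simp, metis append_Cons append_Nil list.distinct(1) word_value.simps(1))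
qed simp

lemma holds_in_iff:
  assumes "is_semigroup S" "u \<noteq> []" "v \<noteq> []"
  shows "holds_in (u, v) S \<longleftrightarrow> (\<forall>\<rho>. (\<forall>x. \<rho> x \<in> carrier S) \<longrightarrow> word_value S \<rho> u = word_value S \<rho> v)"
proof
  assume "holds_in (u, v) S"
  then show "\<forall>\<rho>. (\<forall>x. \<rho> x \<in> carrier S) \<longrightarrow> word_value S \<rho> u = word_value S \<rho> v"
    using word_value_morphism[OF assms(1)] by (simp add: holds_in_def)
next
  assume *: "\<forall>\<rho>. (\<forall>x. \<rho> x \<in> carrier S) \<longrightarrow> word_value S \<rho> u = word_value S \<rho> v"
  show "holds_in (u, v) S"
    unfolding holds_in_def
  proof (intro allI impI)
    fix \<phi> assume \<phi>: "semigroup_morphism free_semigroup S \<phi>"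
    then have "\<forall>x. \<phi> [x] \<in> carrier S" by (simp add: free_semigroup_morphism_iff)
    then have "word_value S (\<lambda>x. \<phi> [x]) u = word_value S (\<lambda>x. \<phi> [x]) v"
      by (rule *[THEN spec, THEN mp, of "\<lambda>x. \<phi> [x]"])
    then show "\<phi> (fst (u, v)) = \<phi> (snd (u, v))"
      unfolding fst_conv snd_conv morphism_word_value[OF \<phi> assms(2)] morphism_word_value[OF \<phi> assms(3)] .
  qed
qed

text \<open>Transport of structure into the universe: the models needed arise on other types,
  whereas varieties consist of semigroups on \<open>'u\<close>.\<close>

definition image_sgrp :: "('a \<Rightarrow> 'b) \<Rightarrow> 'a sgrp \<Rightarrow> 'b sgrp" where
  "image_sgrp f T = \<lparr>carrier = f ` carrier T,
     sgmult = \<lambda>x y. f (inv_into (carrier T) f x \<cdot>\<^bsub>T\<^esub> inv_into (carrier T) f y)\<rparr>"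

context
  fixes T :: "'a sgrp" and f :: "'a \<Rightarrow> 'b"
  assumes T: "is_semigroup T" and f: "inj_on f (carrier T)"
begin

lemma image_sgrp_simps:
  "carrier (image_sgrp f T) = f ` carrier T"
  "x \<in> carrier T \<Longrightarrow> y \<in> carrier T \<Longrightarrow> f x \<cdot>\<^bsub>image_sgrp f T\<^esub> f y = f (x \<cdot>\<^bsub>T\<^esub> y)"
  by (simp_all add: image_sgrp_def f)

lemma is_semigroup_image: "is_semigroup (image_sgrp f T)"
  using T unfolding is_semigroup_def by (auto simp: image_sgrp_simps)

lemma word_value_image:
  assumes "\<And>x. x \<in> set w \<Longrightarrow> \<rho> x \<in> carrier T" "w \<noteq> []"
  shows "word_value (image_sgrp f T) (\<lambda>x. f (\<rho> x)) w = f (word_value T \<rho> w)"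
  using assms by (induction w) (auto simp: image_sgrp_simps word_value_closed[OF T])

lemma holds_in_image:
  assumes "u \<noteq> []" "v \<noteq> []"
  shows "holds_in (u, v) (image_sgrp f T) \<longleftrightarrow> holds_in (u, v) T"
proof -
  have "(\<forall>x. \<rho> x \<in> f ` carrier T) \<longleftrightarrow> (\<exists>\<rho>'. (\<forall>x. \<rho>' x \<in> carrier T) \<and> \<rho> = (\<lambda>x. f (\<rho>' x)))" for \<rho> :: "nat \<Rightarrow> 'b"
  proof
    assume "\<forall>x. \<rho> x \<in> f ` carrier T"
    then show "\<exists>\<rho>'. (\<forall>x. \<rho>' x \<in> carrier T) \<and> \<rho> = (\<lambda>x. f (\<rho>' x))"
      by (intro exI[of _ "\<lambda>x. inv_into (carrier T) f (\<rho> x)"]) (auto simp: inv_into_into f_inv_into_f)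
  qed auto
  moreover have "f (word_value T \<rho> u) = f (word_value T \<rho> v) \<longleftrightarrow> word_value T \<rho> u = word_value T \<rho> v"
    if "\<forall>x. \<rho> x \<in> carrier T" for \<rho>
    using that by (intro inj_on_eq_iff[OF f] word_value_closed[OF T] assms) auto
  ultimately show ?thesis
    unfolding holds_in_iff[OF is_semigroup_image assms] holds_in_iff[OF T assms] image_sgrp_simps(1)
    using word_value_image assms by (smt (verit, del_insts))
qed

lemma finitely_generated_image:
  assumes "finitely_generated T"
  shows "finitely_generated (image_sgrp f T)"
proof -
  obtain X where X: "finite X" "X \<subseteq> carrier T" "generated_subsemigroup T X = carrier T"
    using assms by (auto simp: finitely_generated_def)
  let ?T = "image_sgrp f T"
  have "f x \<in> generated_subsemigroup ?T (f ` X)" if "x \<in> generated_subsemigroup T X" for x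
    using that
  proof induction
    case (mult x y)
    then show ?case
      using generated_subsemigroup.mult[of "f x" ?T "f ` X" "f y"] X(3) image_sgrp_simps(2)[of x y] by auto
  qed (auto intro: generated_subsemigroup.gen)
  moreover have "y \<in> f ` carrier T" if "y \<in> generated_subsemigroup ?T (f ` X)" for y
    using that
  proof induction
    case (mult x y)
    then show ?case using image_sgrp_simps(2) is_semigroupD(1)[OF T] by auto
  qed (use X(2) in auto)
  ultimately have "generated_subsemigroup ?T (f ` X) = carrier ?T"
    unfolding image_sgrp_simps(1) using X(3) by blast
  then show ?thesis
    unfolding finitely_generated_def using X(1,2) image_sgrp_simps(1) by (intro exI[of _ "f ` X"]) auto
qed

end

lemma countable_inj_on_infinite:
  assumes "countable A" "infinite (UNIV :: 'u set)"
  obtains f :: "'a \<Rightarrow> 'u" where "inj_on f A"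
proof -
  obtain g :: "nat \<Rightarrow> 'u" where g: "inj g"
    using assms(2) infinite_countable_subset by blast
  have "inj_on (g \<circ> to_nat_on A) A"
    using comp_inj_on[OF inj_on_to_nat_on[OF assms(1)], of g] g inj_on_subset by blast
  then show thesis by (rule that)
qed

text \<open>\<open>S\<close> may be too large to be copied into \<open>'u\<close>. But a failure of
  an identity is witnessed by one morphism, and its image is a countable subsemigroup, which embeds
  into any infinite type.\<close>

lemma holds_in_of_subvariety:
  fixes S :: "'a sgrp"
  assumes S: "is_semigroup S" and U: "infinite (UNIV :: 'u set)"
    and sub: "(generated_variety S :: 'u sgrp set) \<subseteq> models \<Sigma>" and e: "(u, v) \<in> \<Sigma>" and uv: "u \<noteq> []" "v \<noteq> []"
  shows "holds_in (u, v) S"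
  unfolding holds_in_def
proof (intro allI impI)
  fix \<phi> assume \<phi>: "semigroup_morphism free_semigroup S \<phi>"
  define S0 where "S0 = \<lparr>carrier = \<phi> ` {w. w \<noteq> []}, sgmult = sgmult S\<rparr>"
  have S0: "is_semigroup S0"
    using S \<phi> unfolding free_semigroup_morphism_iff is_semigroup_def S0_def
    by (auto simp: image_iff) (metis append_is_Nil_conv)
  have S0S: "semigroup_morphism free_semigroup S0 \<psi> \<Longrightarrow> semigroup_morphism free_semigroup S \<psi>" for \<psi>
    using \<phi> unfolding free_semigroup_morphism_iff S0_def by auto
  have "semigroup_morphism free_semigroup S0 \<phi>"
    using \<phi> unfolding free_semigroup_morphism_iff S0_def by auto
  moreover have "holds_in (u, v) S0"
  proof -
    have "countable (carrier S0)" by (auto simp: S0_def)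
    then obtain f :: "'a \<Rightarrow> 'u" where f: "inj_on f (carrier S0)"
      using countable_inj_on_infinite[OF _ U] by blast
    have "holds_in d (image_sgrp f S0)" if "d \<in> identities" "holds_in d S" for d
    proof -
      obtain x y where d0: "d = (x, y)" by (cases d)
      then have d: "d = (x, y)" "x \<noteq> []" "y \<noteq> []"
        using that(1) by (auto simp: identities_def free_semigroup_def)
      have "holds_in d S0"
        using that(2) S0S by (auto simp: holds_in_def)
      then show ?thesis
        unfolding d(1) holds_in_image[OF S0 f d(2,3)] .
    qed
    then have "image_sgrp f S0 \<in> generated_variety S"
      using is_semigroup_image[OF S0 f] by (auto simp: generated_variety_def models_def)
    then have "holds_in (u, v) (image_sgrp f S0)"
      using sub e by (auto simp: models_def)
    then show ?thesis using holds_in_image[OF S0 f uv] by simp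
  qed
  ultimately show "\<phi> (fst (u, v)) = \<phi> (snd (u, v))"
    by (simp add: holds_in_def)
qed

definition factor :: "nat \<Rightarrow> letter list \<Rightarrow> bool" where
  "factor r w \<longleftrightarrow> (\<exists>m. sublist w (block_word r m))"

text \<open>The Rees quotient of the free semigroup by the ideal of all words that are not factors of some
  block word, with \<open>None\<close> as its zero.\<close>

definition factor_sgrp :: "nat \<Rightarrow> letter list option sgrp" where
  "factor_sgrp r = \<lparr>carrier = insert None (Some ` {w. w \<noteq> [] \<and> factor r w}),
     sgmult = \<lambda>x y. case (x, y) of (Some v, Some w) \<Rightarrow> if factor r (v @ w) then Some (v @ w) else None | _ \<Rightarrow> None\<rparr>"

lemma factor_sublist: "factor r w \<Longrightarrow> sublist v w \<Longrightarrow> factor r v"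
  unfolding factor_def by (elim exE, rule exI, rule sublist_order.order_trans)

lemma factor_append: "factor r (v @ w) \<Longrightarrow> factor r v \<and> factor r w"
  using factor_sublist[of r "v @ w" v] factor_sublist[of r "v @ w" w] by auto

lemma factor_sgrp_mult:
  "Some v \<cdot>\<^bsub>factor_sgrp r\<^esub> Some w = (if factor r (v @ w) then Some (v @ w) else None)"
  "None \<cdot>\<^bsub>factor_sgrp r\<^esub> y = None" "x \<cdot>\<^bsub>factor_sgrp r\<^esub> None = None"
  by (simp_all add: factor_sgrp_def split: option.split)

lemma carrier_factor_sgrp: "carrier (factor_sgrp r) = insert None (Some ` {w. w \<noteq> [] \<and> factor r w})"
  by (simp add: factor_sgrp_def)

lemma is_semigroup_factor_sgrp: "is_semigroup (factor_sgrp r)"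
proof -
  have "(x \<cdot>\<^bsub>factor_sgrp r\<^esub> y) \<cdot>\<^bsub>factor_sgrp r\<^esub> z = x \<cdot>\<^bsub>factor_sgrp r\<^esub> (y \<cdot>\<^bsub>factor_sgrp r\<^esub> z)" for x y z
  proof (cases x; cases y; cases z)
    fix a b c assume [simp]: "x = Some a" "y = Some b" "z = Some c"
    show ?thesis
      using factor_append[of r "a @ b" c] factor_append[of r a "b @ c"] by (auto simp: factor_sgrp_mult)
  qed (simp_all add: factor_sgrp_mult)
  then show ?thesis
    unfolding is_semigroup_def by (auto simp: factor_sgrp_mult carrier_factor_sgrp)
qed

lemma word_value_factor_sgrp:
  assumes "\<And>x. x \<in> set u \<Longrightarrow> \<rho> x \<in> carrier (factor_sgrp r)" "u \<noteq> []"
  shows "word_value (factor_sgrp r) \<rho> u =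
    (if (\<forall>x\<in>set u. \<rho> x \<noteq> None) \<and> factor r (subst (\<lambda>x. the (\<rho> x)) u) then Some (subst (\<lambda>x. the (\<rho> x)) u) else None)"
  using assms
proof (induction u)
  case (Cons x u)
  show ?case
  proof (cases "u = []")
    case True
    then show ?thesis using Cons.prems by (cases "\<rho> x") (auto simp: carrier_factor_sgrp)
  next
    case False
    then have IH: "word_value (factor_sgrp r) \<rho> u =
      (if (\<forall>x\<in>set u. \<rho> x \<noteq> None) \<and> factor r (subst (\<lambda>x. the (\<rho> x)) u) then Some (subst (\<lambda>x. the (\<rho> x)) u) else None)"
      using Cons by auto
    show ?thesis
      using False by (cases "\<rho> x") (auto simp: IH factor_sgrp_mult dest: factor_append)
  qed
qed simp

text \<open>A nonzero value of either side forces the same value of the other, which takes rigidity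
  in both directions; otherwise both sides are zero.\<close>

lemma factor_sgrp_holds_in:
  fixes u v :: "nat list"
  assumes "rigid u v" "rigid v u" "card (set u) \<le> n" "card (set v) \<le> n" "u \<noteq> []" "v \<noteq> []"
  shows "holds_in (u, v) (factor_sgrp (n + 3))"
  unfolding holds_in_iff[OF is_semigroup_factor_sgrp assms(5,6)]
proof (intro allI impI)
  fix \<rho> :: "nat \<Rightarrow> letter list option" assume \<rho>: "\<forall>x. \<rho> x \<in> carrier (factor_sgrp (n + 3))"
  let ?val = "word_value (factor_sgrp (n + 3)) \<rho>"
  have *: "?val v = Some w" if r: "rigid u v" and c: "card (set u) \<le> n" and ne: "u \<noteq> []" "v \<noteq> []" and w: "?val u = Some w"
    for u v :: "nat list" and w
  proof -
    \<comment> \<open>The default word keeps the substitution nonerasing. It serves variables with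
      value zero, and these do not occur in a word of nonzero value.\<close>
    define \<theta> :: "nat \<Rightarrow> letter list" where "\<theta> x = (case \<rho> x of None \<Rightarrow> [(0, 0)] | Some w \<Rightarrow> w)" for x
    have ne\<theta>: "nonerasing \<theta>"
    proof
      fix x show "\<theta> x \<noteq> []"
        using \<rho>[rule_format, of x] by (auto simp: \<theta>_def carrier_factor_sgrp split: option.splits)
    qed
    have \<theta>: "subst (\<lambda>x. the (\<rho> x)) y = subst \<theta> y" if "\<forall>x\<in>set y. \<rho> x \<noteq> None" for y
      using that by (intro subst_cong) (auto simp: \<theta>_def)
    have u: "\<forall>x\<in>set u. \<rho> x \<noteq> None" "factor (n + 3) (subst \<theta> u)" "w = subst \<theta> u"
      using w word_value_factor_sgrp[of u \<rho> "n + 3"] \<rho> ne(1) \<theta>[of u] by (auto split: if_splits)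
    then obtain m where "sublist (subst \<theta> u) (block_word (n + 3) m)" by (auto simp: factor_def)
    from sublist_block_word[OF ne\<theta> c this, of v] r have f: "fits u" and e: "subst \<theta> u = subst \<theta> v" by auto
    have v: "\<forall>x\<in>set v. \<rho> x \<noteq> None" using u(1) rigid_set_subset[OF f r] by blast
    show ?thesis
      using word_value_factor_sgrp[of v \<rho> "n + 3"] \<rho> ne(2) \<theta>[OF v] u(2,3) e v by simp
  qed
  show "?val u = ?val v"
    using *[OF assms(1,3,5,6)] *[OF assms(2,4,6,5)] by (cases "?val u"; cases "?val v") auto
qed

lemma infinite_factor_sgrp: "2 \<le> r \<Longrightarrow> infinite (carrier (factor_sgrp r))"
proof
  assume r: "2 \<le> r" and fin: "finite (carrier (factor_sgrp r))"
  have "inj (\<lambda>m. Some (block_word r m))"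
  proof (rule injI)
    fix m m' assume "Some (block_word r m) = Some (block_word r m')"
    then have "r ^ m = r ^ m'" using length_block_word by (metis option.inject)
    then show "m = m'" using r power_inject_exp[of r m m'] by simp
  qed
  moreover have "block_word r m \<noteq> []" for m
    using length_block_word[of r m] r by (metis length_0_conv not_numeral_le_zero power_not_zero)
  then have "range (\<lambda>m. Some (block_word r m)) \<subseteq> carrier (factor_sgrp r)"
    by (auto simp: carrier_factor_sgrp factor_def)
  ultimately show False
    using fin by (meson finite_imageD finite_subset infinite_UNIV_nat)
qed

lemma finitely_generated_factor_sgrp: "0 < r \<Longrightarrow> finitely_generated (factor_sgrp r)"
proof -
  assume r: "0 < r"
  let ?X = "insert None ((\<lambda>a. Some [a]) ` {a \<in> {..<r} \<times> {..<r}. factor r [a]})"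
  let ?G = "generated_subsemigroup (factor_sgrp r) ?X"
  have X: "?X \<subseteq> carrier (factor_sgrp r)" by (auto simp: carrier_factor_sgrp)
  have letters: "a \<in> {..<r} \<times> {..<r}" if "factor r [a]" for a
    using that block_word_letters[OF r] set_mono_sublist unfolding factor_def by fastforce
  have "Some w \<in> ?G" if "w \<noteq> []" "factor r w" for w
    using that
  proof (induction w)
    case (Cons a w)
    have a: "factor r [a]" "factor r w" using factor_append[of r "[a]" w] Cons.prems by auto
    have ga: "Some [a] \<in> ?G"
      using letters[OF a(1)] a(1) by (intro generated_subsemigroup.gen) auto
    show ?case
    proof (cases "w = []")
      case False
      then have "Some [a] \<cdot>\<^bsub>factor_sgrp r\<^esub> Some w \<in> ?G"
        using generated_subsemigroup.mult[OF ga Cons.IH[OF False a(2)]] by simp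
      then show ?thesis using Cons.prems by (simp add: factor_sgrp_mult)
    qed (use ga in simp)
  qed simp
  moreover have "None \<in> ?G" by (intro generated_subsemigroup.gen) simp
  ultimately have "carrier (factor_sgrp r) \<subseteq> ?G" by (auto simp: carrier_factor_sgrp)
  moreover have "x \<in> carrier (factor_sgrp r)" if "x \<in> ?G" for x
    using that
  proof induction
    case (mult x y)
    show ?case by (rule is_semigroupD(1)[OF is_semigroup_factor_sgrp mult(3,4)])
  qed (use X in auto)
  ultimately show ?thesis
    unfolding finitely_generated_def using X by (intro exI[of _ ?X]) auto
qed

lemma no_finitely_based_overvariety:
  fixes S :: "'a sgrp"
  assumes S: "is_semigroup S" and U: "infinite (UNIV :: 'u set)"
    and isoterm: "\<And>k w. k > 0 \<Longrightarrow> w \<noteq> [] \<Longrightarrow> holds_in (zimin k, w) S \<Longrightarrow> w = zimin k"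
  shows "\<not> (\<exists>W :: 'u sgrp set. finitely_based W \<and> locally_finite W \<and> generated_variety S \<subseteq> W)"
proof
  assume "\<exists>W :: 'u sgrp set. finitely_based W \<and> locally_finite W \<and> generated_variety S \<subseteq> W"
  then obtain \<Sigma> where \<Sigma>: "\<Sigma> \<subseteq> identities" "finite \<Sigma>" "locally_finite (models \<Sigma> :: 'u sgrp set)"
    "(generated_variety S :: 'u sgrp set) \<subseteq> models \<Sigma>"
    by (auto simp: finitely_based_def)
  have \<Sigma>_neq: "u \<noteq> [] \<and> v \<noteq> []" if "(u, v) \<in> \<Sigma>" for u v
    using \<Sigma>(1) that by (auto simp: identities_def free_semigroup_def)
  have rigid: "rigid u v" if h: "holds_in (u, v) S" and ne: "u \<noteq> []" "v \<noteq> []" for u v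
    unfolding rigid_def
  proof (intro allI impI)
    fix k \<phi> assume \<phi>: "nonerasing \<phi>" "sublist (subst \<phi> u) (zimin k)"
    then obtain s t where st: "zimin k = s @ subst \<phi> u @ t" by (auto simp: sublist_def)
    have n: "x \<noteq> [] \<Longrightarrow> subst \<phi> x \<noteq> []" for x using subst_neq_Nil[OF \<phi>(1)] .
    \<comment> \<open>An occurrence of the image of \<open>u\<close> in a Zimin word turns the
      identity into one whose left side is that Zimin word, where the isoterm property
      applies.\<close>
    have "holds_in (zimin k, s @ subst \<phi> v @ t) S"
      unfolding holds_in_def st fst_conv snd_conv
    proof (intro allI impI)
      fix \<psi> assume \<psi>: "semigroup_morphism free_semigroup S \<psi>"
      then have "semigroup_morphism free_semigroup S (\<lambda>x. \<psi> (subst \<phi> x))"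
        using n unfolding free_semigroup_morphism_iff by simp
      from h[unfolded holds_in_def, rule_format, OF this]
      have "\<psi> (subst \<phi> u) = \<psi> (subst \<phi> v)" by simp
      then show "\<psi> (s @ subst \<phi> u @ t) = \<psi> (s @ subst \<phi> v @ t)"
        using \<psi> n[OF ne(1)] n[OF ne(2)] unfolding free_semigroup_morphism_iff
        by (cases "s = []"; cases "t = []") simp_all
    qed
    moreover have "k > 0" using st n[OF ne(1)] by (cases k) auto
    ultimately show "subst \<phi> u = subst \<phi> v"
      using isoterm[of k "s @ subst \<phi> v @ t"] st n[OF ne(2)] by simp
  qed
  have holds: "holds_in (u, v) S \<and> holds_in (v, u) S" if "(u, v) \<in> \<Sigma>" for u v
    using holds_in_of_subvariety[OF S U \<Sigma>(4) that] \<Sigma>_neq[OF that] by (auto simp: holds_in_def)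
  \<comment> \<open>Finiteness of the basis enters here: one \<open>n\<close> serves all identities
    and determines the block length.\<close>
  obtain n where n: "\<And>u v. (u, v) \<in> \<Sigma> \<Longrightarrow> card (set u) \<le> n \<and> card (set v) \<le> n"
  proof
    fix u v assume "(u, v) \<in> \<Sigma>"
    then have "card (set u) + card (set v) \<le> (\<Sum>(u, v)\<in>\<Sigma>. card (set u) + card (set v))"
      using member_le_sum[of "(u, v)" \<Sigma> "\<lambda>(u, v). card (set u) + card (set v)"] \<Sigma>(2) by auto
    then show "card (set u) \<le> (\<Sum>(u, v)\<in>\<Sigma>. card (set u) + card (set v)) \<and>
      card (set v) \<le> (\<Sum>(u, v)\<in>\<Sigma>. card (set u) + card (set v))" by simp
  qed
  let ?F = "factor_sgrp (n + 3)"
  have "countable (carrier ?F)" by simp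
  then obtain f :: "letter list option \<Rightarrow> 'u" where f: "inj_on f (carrier ?F)"
    using countable_inj_on_infinite[OF _ U] by blast
  note F = is_semigroup_factor_sgrp
  have "holds_in (u, v) (image_sgrp f ?F)" if "(u, v) \<in> \<Sigma>" for u v
    using holds[OF that] \<Sigma>_neq[OF that] n[OF that] rigid
    by (simp add: holds_in_image[OF F f] factor_sgrp_holds_in)
  then have "image_sgrp f ?F \<in> models \<Sigma>"
    using is_semigroup_image[OF F f] by (auto simp: models_def)
  moreover have "finitely_generated (image_sgrp f ?F)"
    by (intro finitely_generated_image[OF F f] finitely_generated_factor_sgrp) simp
  ultimately have "finite (carrier (image_sgrp f ?F))"
    using \<Sigma>(3) by (simp add: locally_finite_def)
  then show False
    using infinite_factor_sgrp[of "n + 3"] finite_imageD[OF _ f] by (simp add: image_sgrp_simps[OF F f])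
qed

section \<open>Sign characters on gaps and a matrix that counts to one\<close>

section \<open>Zimin words are isoterms for triangular matrices\<close>

text \<open>The list \<open>cs\<close> holds one coefficient per gap of the word, including both
  ends; the accumulator is the sign character of the prefix before the gap.\<close>

fun path_sum :: "(nat \<Rightarrow> 'f::field) \<Rightarrow> 'f \<Rightarrow> 'f list \<Rightarrow> nat list \<Rightarrow> 'f" where
  "path_sum \<epsilon> a (c # cs) (y # ys) = c * a + path_sum \<epsilon> (\<epsilon> y * a) cs ys"
| "path_sum \<epsilon> a (c # cs) [] = c * a"
| "path_sum \<epsilon> a [] ys = 0"

definition signs :: "(nat \<Rightarrow> 'f::field) \<Rightarrow> bool" where
  "signs \<epsilon> \<longleftrightarrow> (\<forall>y. \<epsilon> y \<in> {1, -1})"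

lemma path_sum_mult: "path_sum \<epsilon> a cs ys = a * path_sum \<epsilon> 1 cs ys"
proof (induction cs arbitrary: a ys)
  case (Cons c cs)
  show ?case
  proof (cases ys)
    case (Cons y ys')
    then show ?thesis
      using Cons.IH[of "\<epsilon> y * a" ys'] Cons.IH[of "\<epsilon> y" ys'] by (simp add: algebra_simps)
  qed (simp add: mult.commute)
qed simp

lemma path_sum_append:
  "length cs1 = Suc (length ys1) \<Longrightarrow>
   path_sum \<epsilon> a (cs1 @ cs2) (ys1 @ y # ys2) =
   path_sum \<epsilon> a cs1 ys1 + path_sum \<epsilon> (\<epsilon> y * prod_list (map \<epsilon> ys1) * a) cs2 ys2"
proof (induction cs1 arbitrary: a ys1)
  case (Cons c cs1)
  show ?case
  proof (cases ys1)
    case Nil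
    then show ?thesis using Cons.prems by simp
  next
    case (Cons z zs)
    then show ?thesis
      using Cons.IH[of zs "\<epsilon> z * a"] Cons.prems by (simp add: ac_simps)
  qed
qed simp

lemma path_sum_cong: "(\<And>y. y \<in> set ys \<Longrightarrow> \<epsilon> y = \<epsilon>' y) \<Longrightarrow> path_sum \<epsilon> a cs ys = path_sum \<epsilon>' a cs ys"
  by (induction \<epsilon> a cs ys rule: path_sum.induct) auto

text \<open>The prefixes of a Zimin word in \<open>k\<close> letters realize every vector of letter parities exactly
  once, so their sign characters are linearly independent in characteristic other than two.\<close>

lemma path_sum_zimin_inject:
  fixes cs cs' :: "'f::field list"
  assumes two: "(2 :: 'f) \<noteq> 0"
    and "length cs = Suc (length (zimin k))" "length cs' = Suc (length (zimin k))"
    and "\<And>\<epsilon>. signs \<epsilon> \<Longrightarrow> path_sum \<epsilon> 1 cs (zimin k) = path_sum \<epsilon> 1 cs' (zimin k)"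
  shows "cs = cs'"
  using assms(2-)
proof (induction k arbitrary: cs cs')
  case 0
  obtain c c' where "cs = [c]" "cs' = [c']"
    using 0(1,2) by (auto simp: length_Suc_conv)
  then show ?case using 0(3)[of "\<lambda>_. 1"] by (simp add: signs_def)
next
  case (Suc k)
  let ?l = "Suc (length (zimin k))"
  define cs1 cs2 cs1' cs2' where "cs1 = take ?l cs" "cs2 = drop ?l cs" "cs1' = take ?l cs'" "cs2' = drop ?l cs'"
  note defs = this
  have "length (zimin (Suc k)) = Suc (length (zimin k) + length (zimin k))"
    by (simp add: zimin_middle del: zimin.simps)
  then have l: "length cs1 = ?l" "length cs2 = ?l" "length cs1' = ?l" "length cs2' = ?l"
    using Suc.prems(1,2) by (simp_all add: defs)
  have cs: "cs = cs1 @ cs2" "cs' = cs1' @ cs2'" by (simp_all add: defs)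
  have main: "path_sum \<epsilon> 1 cs1 (zimin k) = path_sum \<epsilon> 1 cs1' (zimin k) \<and>
    path_sum \<epsilon> 1 cs2 (zimin k) = path_sum \<epsilon> 1 cs2' (zimin k)" if \<epsilon>: "signs \<epsilon>" for \<epsilon> :: "nat \<Rightarrow> 'f"
  proof -
    let ?P = "\<lambda>c. path_sum \<epsilon> 1 c (zimin k)"
    define \<chi> where "\<chi> = prod_list (map \<epsilon> (zimin k))"
    have "\<epsilon> y \<noteq> 0" for y
      using \<epsilon>[unfolded signs_def, THEN spec, of y] by auto
    then have "prod_list (map \<epsilon> w) \<noteq> 0" for w
      by (induction w) auto
    then have \<chi>0: "\<chi> \<noteq> 0" by (simp add: \<chi>_def)
    \<comment> \<open>The middle letter \<open>k\<close> occurs once, so its sign \<open>t\<close>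
      affects the second half only. Adding the two cases leaves twice the first half, which can be
      cancelled in characteristic other than two.\<close>
    have e: "?P cs1 + t * \<chi> * ?P cs2 = ?P cs1' + t * \<chi> * ?P cs2'" if "t = 1 \<or> t = -1" for t
    proof -
      let ?\<epsilon> = "\<epsilon>(k := t)"
      have s: "signs ?\<epsilon>" using \<epsilon> that by (auto simp: signs_def)
      have c: "path_sum ?\<epsilon> 1 c (zimin k) = ?P c" for c
        by (rule path_sum_cong) (auto simp: set_zimin)
      have p: "prod_list (map ?\<epsilon> (zimin k)) = \<chi>"
        unfolding \<chi>_def by (rule arg_cong[of _ _ prod_list], rule map_cong) (auto simp: set_zimin)
      have sp: "path_sum ?\<epsilon> 1 (c1 @ c2) (zimin (Suc k)) = ?P c1 + t * \<chi> * ?P c2" if "length c1 = ?l" for c1 c2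
      proof -
        have "path_sum ?\<epsilon> 1 (c1 @ c2) (zimin (Suc k)) =
          path_sum ?\<epsilon> 1 c1 (zimin k) + path_sum ?\<epsilon> (t * \<chi>) c2 (zimin k)"
          unfolding zimin_middle using path_sum_append[OF that, of ?\<epsilon> 1 c2 k "zimin k"] p by simp
        also have "path_sum ?\<epsilon> (t * \<chi>) c2 (zimin k) = t * \<chi> * ?P c2"
          unfolding path_sum_mult[of ?\<epsilon> "t * \<chi>"] c ..
        finally show ?thesis by (simp only: c)
      qed
      show ?thesis
        using Suc.prems(3)[OF s] unfolding cs sp[OF l(1)] sp[OF l(3)] .
    qed
    have "2 * ?P cs1 = (?P cs1 + 1 * \<chi> * ?P cs2) + (?P cs1 + (- 1) * \<chi> * ?P cs2)" by simp
    also have "\<dots> = (?P cs1' + 1 * \<chi> * ?P cs2') + (?P cs1' + (- 1) * \<chi> * ?P cs2')"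
      by (simp only: e[OF disjI1[OF refl]] e[OF disjI2[OF refl]])
    also have "\<dots> = 2 * ?P cs1'" by simp
    finally have "2 * ?P cs1 = 2 * ?P cs1'" .
    then have 1: "?P cs1 = ?P cs1'" using two by simp
    then have "\<chi> * ?P cs2 = \<chi> * ?P cs2'" using e[of 1] by simp
    then show ?thesis using 1 \<chi>0 by simp
  qed
  have "cs1 = cs1'" using main l by (intro Suc.IH) auto
  moreover have "cs2 = cs2'" using main l by (intro Suc.IH) auto
  ultimately show ?case using cs by simp
qed

definition runs :: "nat \<Rightarrow> (nat \<times> nat) list \<Rightarrow> nat list" where
  "runs l ps = replicate l 0 @ subst (\<lambda>(y, l). Suc y # replicate l 0) ps"

lemma runs_ex: "\<exists>l ps. w = runs l ps"
proof (induction w)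
  case Nil
  show ?case by (intro exI[of _ 0] exI[of _ "[]"]) (simp add: runs_def)
next
  case (Cons x w)
  then obtain l ps where w: "w = runs l ps" by blast
  show ?case
  proof (cases x)
    case 0
    then show ?thesis using w by (intro exI[of _ "Suc l"] exI[of _ ps]) (simp add: runs_def)
  next
    case (Suc y)
    then show ?thesis using w by (intro exI[of _ 0] exI[of _ "(y, l) # ps"]) (simp add: runs_def)
  qed
qed

lemma unpad_replicate: "unpad (replicate l 0) = []"
  by (simp add: unpad_def)

lemma unpad_Cons: "unpad (x # w) = (if x = 0 then [] else [x - 1]) @ unpad w"
  by (simp add: unpad_def)

lemma unpad_runs: "unpad (runs l ps) = map fst ps"
proof -
  have "unpad (subst (\<lambda>(y, l). Suc y # replicate l 0) ps) = map fst ps"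
    by (induction ps) (auto simp: unpad_Cons unpad_replicate)
  then show ?thesis by (simp add: runs_def unpad_replicate)
qed

lemma zimin_runs: "zimin (Suc k) = runs 1 (map (\<lambda>y. (y, 1)) (zimin k))"
  by (simp add: runs_def pad_def o_def)

text \<open>Row vectors supported on the first four coordinates. The letter \<open>0\<close> acts by \<open>tmat\<close>, chosen such that
  the fourth coordinate of \<open>(a, 0, 0, d) tmat\<^sup>l\<close> is \<open>d + a\<close> if \<open>l = 1\<close> and \<open>d\<close> otherwise.\<close>

fun run :: "(nat \<Rightarrow> 'f::field) \<Rightarrow> 'f \<times> 'f \<times> 'f \<times> 'f \<Rightarrow> nat list \<Rightarrow> 'f \<times> 'f \<times> 'f \<times> 'f" where
  "run \<epsilon> s [] = s"
| "run \<epsilon> (a, b, c, d) (0 # w) = run \<epsilon> (a, a, b, a - 2 * b + c + d) w"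
| "run \<epsilon> (a, b, c, d) (Suc y # w) = run \<epsilon> (\<epsilon> y * a, 0, 0, d) w"

definition fourth :: "'f \<times> 'f \<times> 'f \<times> 'f \<Rightarrow> 'f" where
  "fourth s = snd (snd (snd s))"

abbreviation one_if_one :: "nat \<Rightarrow> 'f::field" where
  "one_if_one l \<equiv> (if l = 1 then 1 else 0)"

lemma run_steady: "run \<epsilon> (a, a, a, d) (replicate l 0 @ w) = run \<epsilon> (a, a, a, d) w"
  by (induction l) (auto simp: algebra_simps)

lemma run_replicate:
  "\<exists>b c. run \<epsilon> (a, 0, 0, d) (replicate l 0 @ w) = run \<epsilon> (a, b, c, d + one_if_one l * a) w"
proof (cases l)
  case 0
  then show ?thesis by auto
next
  case (Suc l1)
  show ?thesis
  proof (cases l1)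
    case 0
    then show ?thesis using Suc by (auto simp: add.commute)
  next
    case (Suc l2)
    then have "replicate l 0 @ w = 0 # 0 # replicate l2 0 @ w"
      using \<open>l = Suc l1\<close> by simp
    moreover have "run \<epsilon> (a, 0, 0, d) (0 # 0 # replicate l2 0 @ w) = run \<epsilon> (a, a, a, d) (replicate l2 0 @ w)" if "l2 > 0"
      using that by (cases l2) (simp_all add: algebra_simps)
    moreover have "run \<epsilon> (a, 0, 0, d) (0 # 0 # w) = run \<epsilon> (a, a, a, d) w"
      by (simp add: algebra_simps)
    ultimately show ?thesis
      using \<open>l = Suc l1\<close> Suc run_steady[of \<epsilon> a d l2 w] by (cases "l2 = 0") auto
  qed
qed

lemma run_runs:
  "fourth (run \<epsilon> (a, 0, 0, d) (runs l ps)) = d + path_sum \<epsilon> a (one_if_one l # map (\<lambda>p. one_if_one (snd p)) ps) (map fst ps)"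
proof (induction ps arbitrary: a d l)
  case Nil
  show ?case
    using run_replicate[of \<epsilon> a d l "[]"] by (auto simp: runs_def fourth_def)
next
  case (Cons p ps)
  obtain y l' where p: "p = (y, l')" by (cases p)
  obtain b c where r: "run \<epsilon> (a, 0, 0, d) (replicate l 0 @ Suc y # runs l' ps) =
    run \<epsilon> (a, b, c, d + one_if_one l * a) (Suc y # runs l' ps)"
    using run_replicate by blast
  have "runs l (p # ps) = replicate l 0 @ Suc y # runs l' ps" by (simp add: runs_def p)
  then show ?case
    using r Cons.IH[of "\<epsilon> y * a" "d + one_if_one l * a" l'] p by (simp add: add.assoc)
qed

text \<open>The Zimin word has coefficient \<open>1\<close> at every gap. By independence of the
  characters so does \<open>w\<close>, hence each of its gaps contains the letter \<open>0\<close>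
  exactly once.\<close>

lemma run_zimin_inject:
  assumes two: "(2 :: 'f::field) \<noteq> 0" and u: "unpad w = zimin k"
    and eq: "\<And>\<epsilon> :: nat \<Rightarrow> 'f. signs \<epsilon> \<Longrightarrow> fourth (run \<epsilon> (1, 0, 0, 0) (zimin (Suc k))) = fourth (run \<epsilon> (1, 0, 0, 0) w)"
  shows "w = zimin (Suc k)"
proof -
  obtain l ps where w: "w = runs l ps" using runs_ex by blast
  have ps: "map fst ps = zimin k" using u unfolding w unpad_runs .
  let ?cs = "one_if_one l # map (\<lambda>p. one_if_one (snd p)) ps :: 'f list"
  let ?cs' = "one_if_one 1 # map (\<lambda>p. one_if_one (snd p)) (map (\<lambda>y. (y, 1)) (zimin k)) :: 'f list"
  have lp: "length ps = length (zimin k)" using arg_cong[OF ps, of length] by simp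
  have "?cs = ?cs'"
  proof (rule path_sum_zimin_inject[OF two, of _ k])
    fix \<epsilon> :: "nat \<Rightarrow> 'f" assume "signs \<epsilon>"
    from eq[OF this] show "path_sum \<epsilon> 1 ?cs (zimin k) = path_sum \<epsilon> 1 ?cs' (zimin k)"
      unfolding w zimin_runs run_runs ps by (simp add: o_def)
  qed (simp_all add: lp)
  then have l: "l = 1" and s: "map (\<lambda>p. one_if_one (snd p)) ps = (map (\<lambda>_. 1) (zimin k) :: 'f list)"
    by (auto split: if_splits simp: o_def)
  have "snd p = 1" if "p \<in> set ps" for p
  proof -
    have "(one_if_one (snd p) :: 'f) \<in> set (map (\<lambda>_. 1) (zimin k))"
      using that unfolding s[symmetric] by auto
    then show ?thesis by (auto split: if_splits)
  qed
  then have "ps = map (\<lambda>y. (y, 1)) (map fst ps)"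
    by (simp add: o_def map_idI prod_eq_iff)
  then show ?thesis unfolding w zimin_runs l ps by simp
qed

text \<open>In contrast to \<open>word_value\<close>, the empty word has a value; it is needed for
  \<open>zimin 0\<close> and for words that \<open>unpad\<close> empties.\<close>

primrec mat_value :: "nat \<Rightarrow> (nat \<Rightarrow> 'f::field mat) \<Rightarrow> nat list \<Rightarrow> 'f mat" where
  "mat_value n \<rho> [] = 1\<^sub>m n"
| "mat_value n \<rho> (x # w) = \<rho> x * mat_value n \<rho> w"

lemma mat_value_carrier: "(\<And>x. \<rho> x \<in> carrier_mat n n) \<Longrightarrow> mat_value n \<rho> w \<in> carrier_mat n n"
  by (induction w) (simp_all add: mult_carrier_mat[of _ n n _ n])

lemma UT_pm_carrier_mat: "A \<in> carrier (UT_pm n) \<Longrightarrow> A \<in> carrier_mat n n"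
  by (simp add: UT_pm_def)

lemma word_value_UT_pm:
  assumes "\<And>x. \<rho> x \<in> carrier (UT_pm n)" "w \<noteq> []"
  shows "word_value (UT_pm n) \<rho> w = mat_value n \<rho> w"
  using assms(2)
proof (induction w)
  case (Cons x w)
  have "\<rho> x \<in> carrier_mat n n" using assms(1) by (rule UT_pm_carrier_mat)
  then show ?case
    using Cons by (cases "w = []") (simp_all add: UT_pm_def)
qed simp

definition state :: "nat \<Rightarrow> 'f::field \<times> 'f \<times> 'f \<times> 'f \<Rightarrow> 'f mat" where
  "state n = (\<lambda>(a, b, c, d). mat 1 n (\<lambda>(i, j). if j = 0 then a else if j = 1 then b else if j = 2 then c else if j = 3 then d else 0))"

text \<open>The two middle coordinates delay the first by one and two steps, and the weights
  \<open>1\<close>, \<open>- 2\<close>, \<open>1\<close> form a second difference. Started from zero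
  delays, it adds \<open>a\<close> at the first step, removes it at the second, and contributes
  nothing afterwards.\<close>

definition tmat :: "nat \<Rightarrow> 'f::field mat" where
  "tmat n = mat n n (\<lambda>(i, j). if (i, j) \<in> {(0, 0), (0, 1), (0, 3), (1, 2), (2, 3), (3, 3)} then 1 else if (i, j) = (1, 3) then - 2 else 0)"

text \<open>Clearing the delay coordinates restarts the count for the next gap, while the
  accumulated fourth coordinate is kept.\<close>

definition gmat :: "nat \<Rightarrow> 'f \<Rightarrow> 'f::field mat" where
  "gmat n e = mat n n (\<lambda>(i, j). if (i, j) = (0, 0) then e else if (i, j) = (3, 3) then 1 else 0)"

lemma state_mult:
  fixes M :: "'f::field mat"
  assumes "M \<in> carrier_mat n n" "4 \<le> n"
  shows "state n (a, b, c, d) * M =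
    mat 1 n (\<lambda>(i, j). a * M $$ (0, j) + b * M $$ (1, j) + c * M $$ (2, j) + d * M $$ (3, j))"
proof (rule eq_matI)
  let ?s = "\<lambda>j. if j = 0 then a else if j = 1 then b else if j = 2 then c else if j = 3 then d else (0 :: 'f)"
  fix i j assume "i < dim_row (mat 1 n (\<lambda>(i, j). a * M $$ (0, j) + b * M $$ (1, j) + c * M $$ (2, j) + d * M $$ (3, j)))"
    and "j < dim_col (mat 1 n (\<lambda>(i, j). a * M $$ (0, j) + b * M $$ (1, j) + c * M $$ (2, j) + d * M $$ (3, j)))"
  then have ij: "i = 0" "j < n" by auto
  have "(state n (a, b, c, d) * M) $$ (i, j) = (\<Sum>l = 0..<n. ?s l * M $$ (l, j))"
    using ij assms(1) by (auto simp: state_def scalar_prod_def intro!: sum.cong)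
  also have "\<dots> = (\<Sum>l\<in>{0, 1, 2, 3}. ?s l * M $$ (l, j))"
    using assms(2) by (intro sum.mono_neutral_right) auto
  also have "\<dots> = a * M $$ (0, j) + b * M $$ (1, j) + c * M $$ (2, j) + d * M $$ (3, j)"
    by simp
  finally show "(state n (a, b, c, d) * M) $$ (i, j) =
    mat 1 n (\<lambda>(i, j). a * M $$ (0, j) + b * M $$ (1, j) + c * M $$ (2, j) + d * M $$ (3, j)) $$ (i, j)"
    using ij by simp
qed (use assms in \<open>auto simp: state_def\<close>)

lemma state_tmat: "4 \<le> n \<Longrightarrow> state n (a, b, c, d) * tmat n = state n (a, a, b, a - 2 * b + c + d)"
  by (subst state_mult) (auto simp: tmat_def state_def intro!: eq_matI)

lemma state_gmat: "4 \<le> n \<Longrightarrow> state n (a, b, c, d) * gmat n e = state n (e * a, 0, 0, d)"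
  by (subst state_mult) (auto simp: gmat_def state_def intro!: eq_matI)

lemma tmat_UT: "tmat n \<in> carrier (UT_pm n)"
  by (auto simp: UT_pm_def tmat_def upper_triangular_def)

lemma gmat_UT: "e \<in> {1, -1} \<Longrightarrow> gmat n e \<in> carrier (UT_pm n)"
  by (auto simp: UT_pm_def gmat_def upper_triangular_def)

lemma one_UT: "1\<^sub>m n \<in> carrier (UT_pm n)"
  by (auto simp: UT_pm_def)

lemma zero_UT: "0\<^sub>m n n \<in> carrier (UT_pm n)"
  by (auto simp: UT_pm_def upper_triangular_def)

lemma state_mat_value:
  assumes "4 \<le> n" "\<rho> 0 = tmat n" "\<And>y. \<rho> (Suc y) = gmat n (\<epsilon> y)"
  shows "state n s * mat_value n \<rho> w = state n (run \<epsilon> s w)"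
proof (induction w arbitrary: s)
  case Nil
  show ?case by (cases s) (simp add: state_def)
next
  case (Cons x w)
  obtain a b c d where s: "s = (a, b, c, d)" by (cases s)
  have \<rho>: "\<rho> x \<in> carrier_mat n n" for x
    using assms(2,3) by (cases x) (simp_all add: tmat_def gmat_def)
  have "state n s * mat_value n \<rho> (x # w) = (state n s * \<rho> x) * mat_value n \<rho> w"
    using \<rho> mat_value_carrier[of \<rho> n w]
    by (simp add: assoc_mult_mat[of _ 1 n _ n _ n] state_def split: prod.split)
  also have "\<dots> = state n (run \<epsilon> s (x # w))"
    using assms by (cases x) (simp_all add: s state_tmat state_gmat Cons.IH)
  finally show ?case .
qed

lemma mat_value_unpad:
  assumes "\<And>x. \<rho> x \<in> carrier_mat n n"
  shows "mat_value n (case_nat (1\<^sub>m n) \<rho>) w = mat_value n \<rho> (unpad w)"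
proof (induction w)
  case (Cons x w)
  then show ?case
    using mat_value_carrier[of \<rho> n "unpad w"] assms by (cases x) (simp_all add: unpad_Cons)
qed simp

lemma mat_value_zimin_inject:
  assumes two: "(2 :: 'f::field) \<noteq> 0" and n: "4 \<le> n"
    and "\<And>\<rho>. (\<And>x. \<rho> x \<in> carrier (UT_pm n)) \<Longrightarrow> mat_value n \<rho> (zimin k) = (mat_value n \<rho> w :: 'f mat)"
  shows "w = zimin k"
  using assms(3)
proof (induction k arbitrary: w)
  case 0
  show ?case
  proof (cases w)
    case (Cons x w')
    \<comment> \<open>Zero matrices separate every nonempty word from the empty one.\<close>
    have "(1\<^sub>m n :: 'f mat) = 0\<^sub>m n n * mat_value n (\<lambda>_. 0\<^sub>m n n) w'"
      using 0[of "\<lambda>_. 0\<^sub>m n n"] Cons by (simp add: zero_UT)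
    also have "\<dots> = 0\<^sub>m n n"
      by (rule left_mult_zero_mat[OF mat_value_carrier]) simp
    finally have "(1\<^sub>m n :: 'f mat) $$ (0, 0) = 0\<^sub>m n n $$ (0, 0)" by simp
    then show ?thesis using n by simp
  qed simp
next
  case (Suc k)
  \<comment> \<open>Assigning the identity matrix to the letter \<open>0\<close> erases it, which
    leads back to \<open>zimin k\<close>.\<close>
  have "unpad w = zimin k"
  proof (rule Suc.IH)
    fix \<rho> :: "nat \<Rightarrow> 'f mat" assume \<rho>: "\<And>x. \<rho> x \<in> carrier (UT_pm n)"
    have "case_nat (1\<^sub>m n) \<rho> x \<in> carrier (UT_pm n)" for x
      using \<rho> by (simp add: one_UT split: nat.split)
    note e = Suc.prems[of "case_nat (1\<^sub>m n) \<rho>", OF this]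
    have "unpad (zimin (Suc k)) = zimin k" by (simp add: unpad_Cons unpad_pad)
    then show "mat_value n \<rho> (zimin k) = mat_value n \<rho> (unpad w)"
      using e unfolding mat_value_unpad[of \<rho>, OF UT_pm_carrier_mat[OF \<rho>]] by (simp del: zimin.simps)
  qed
  moreover have "fourth (run \<epsilon> (1, 0, 0, 0) (zimin (Suc k))) = fourth (run \<epsilon> (1, 0, 0, 0) w)" if "signs \<epsilon>" for \<epsilon> :: "nat \<Rightarrow> 'f"
  proof -
    let ?\<rho> = "case_nat (tmat n) (\<lambda>y. gmat n (\<epsilon> y))"
    have "?\<rho> x \<in> carrier (UT_pm n)" for x
    proof (cases x)
      case (Suc y)
      then show ?thesis
        using gmat_UT[OF that[unfolded signs_def, THEN spec, of y]] by simp
    qed (simp add: tmat_UT)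
    from Suc.prems[of ?\<rho>, OF this]
    have "state n (1, 0, 0, 0) * mat_value n ?\<rho> (zimin (Suc k)) = state n (1, 0, 0, 0) * mat_value n ?\<rho> w" by simp
    then have "state n (run \<epsilon> (1, 0, 0, 0) (zimin (Suc k))) = state n (run \<epsilon> (1, 0, 0, 0) w)"
      by (simp only: state_mat_value[OF n, of ?\<rho> \<epsilon>] nat.case)
    moreover have "state n s $$ (0, 3) = fourth s" for s :: "'f \<times> 'f \<times> 'f \<times> 'f"
      using n by (cases s) (simp add: state_def fourth_def)
    ultimately show ?thesis by metis
  qed
  ultimately show ?case by (rule run_zimin_inject[OF two])
qed

lemma zimin_isoterm_UT_pm:
  assumes two: "(2 :: 'f::field) \<noteq> 0" and n: "4 \<le> n" and "k > 0" "w \<noteq> []"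
    and h: "holds_in (zimin k, w) (UT_pm n :: 'f mat sgrp)"
  shows "w = zimin k"
proof (rule mat_value_zimin_inject[OF two n])
  fix \<rho> :: "nat \<Rightarrow> 'f mat" assume \<rho>: "\<And>x. \<rho> x \<in> carrier (UT_pm n)"
  have z: "zimin k \<noteq> []" using assms(3) by (cases k) auto
  show "mat_value n \<rho> (zimin k) = mat_value n \<rho> w"
    using h \<rho> unfolding holds_in_iff[OF is_semigroup_UT_pm z assms(4)]
    by (simp add: word_value_UT_pm z assms(4))
qed

section \<open>Finiteness of the set of entry functions\<close>

section \<open>Local finiteness\<close>

text \<open>By commutativity all occurrences of one generator collect into a single power, of which
  only finitely many exist.\<close>

lemma (in Groups.comm_monoid) finite_generated:
  assumes "finite X" "\<And>x. x \<in> X \<Longrightarrow> finite (range (\<lambda>c. (f x ^^ c) \<^bold>1))"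
  shows "finite {foldr f xs \<^bold>1 | xs. set xs \<subseteq> X}"
  using assms
proof (induction X)
  case empty
  then show ?case by simp
next
  case (insert x X)
  let ?P = "range (\<lambda>c. (f x ^^ c) \<^bold>1)" and ?M = "{foldr f xs \<^bold>1 | xs. set xs \<subseteq> X}"
  have 1: "foldr f xs \<^bold>1 = (f x ^^ count_list xs x) \<^bold>1 \<^bold>* foldr f (filter (\<lambda>y. y \<noteq> x) xs) \<^bold>1" for xs
    by (induction xs) (auto simp: ac_simps)
  have 2: "foldr f (filter (\<lambda>y. y \<noteq> x) xs) \<^bold>1 \<in> ?M" if "set xs \<subseteq> insert x X" for xs
    using that by (intro CollectI exI conjI) (rule refl, auto)
  have "foldr f xs \<^bold>1 \<in> (\<lambda>(a, b). a \<^bold>* b) ` (?P \<times> ?M)" if "set xs \<subseteq> insert x X" for xs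
    by (rule image_eqI[of _ _ "((f x ^^ count_list xs x) \<^bold>1, foldr f (filter (\<lambda>y. y \<noteq> x) xs) \<^bold>1)"])
      (simp add: 1[of xs], rule SigmaI, rule rangeI, rule 2[OF that])
  then have "{foldr f xs \<^bold>1 | xs. set xs \<subseteq> insert x X} \<subseteq> (\<lambda>(a, b). a \<^bold>* b) ` (?P \<times> ?M)"
    by blast
  moreover have "finite (?P \<times> ?M)" using insert by blast
  ultimately show ?case by (meson finite_imageI finite_subset)
qed

definition fadd :: "('x \<Rightarrow> 'f::comm_ring_1) \<Rightarrow> ('x \<Rightarrow> 'f) \<Rightarrow> 'x \<Rightarrow> 'f" where
  "fadd g h = (\<lambda>z. g z + h z)"

definition fmul :: "('x \<Rightarrow> 'f::comm_ring_1) \<Rightarrow> ('x \<Rightarrow> 'f) \<Rightarrow> 'x \<Rightarrow> 'f" where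
  "fmul g h = (\<lambda>z. g z * h z)"

lemma finite_fsums:
  fixes X :: "('x \<Rightarrow> 'f::comm_ring_1) set"
  assumes "finite X" "p > 0" "of_nat p = (0 :: 'f)"
  shows "finite {foldr fadd xs (\<lambda>_. 0) | xs. set xs \<subseteq> X}"
proof -
  interpret Groups.comm_monoid "fadd :: ('x \<Rightarrow> 'f) \<Rightarrow> _" "\<lambda>_. 0"
    by unfold_locales (auto simp: fadd_def fmul_def ac_simps)
  have pow: "(fadd x ^^ c) (\<lambda>_. 0) = (\<lambda>z. of_nat c * x z)" for x :: "'x \<Rightarrow> 'f" and c
    by (induction c) (auto simp: fadd_def algebra_simps)
  have "of_nat c = (of_nat (c mod p) :: 'f)" for c
  proof -
    have "of_nat c = (of_nat (p * (c div p) + c mod p) :: 'f)" by simp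
    also have "\<dots> = of_nat (c mod p)" unfolding of_nat_add of_nat_mult using assms(3) by simp
    finally show ?thesis .
  qed
  then have "range (\<lambda>c. (fadd x ^^ c) (\<lambda>_. 0)) \<subseteq> (\<lambda>c z. of_nat c * x z) ` {..<p}" for x :: "'x \<Rightarrow> 'f"
    using assms(2) by (auto simp: pow image_iff) (metis lessThan_iff mod_less_divisor)
  then have "finite (range (\<lambda>c. (fadd x ^^ c) (\<lambda>_. 0)))" for x :: "'x \<Rightarrow> 'f"
    by (rule finite_subset) simp
  then show ?thesis by (intro finite_generated assms(1))
qed

lemma finite_fprods:
  fixes X :: "('x \<Rightarrow> 'f::comm_ring_1) set"
  assumes "finite X" "\<And>x z. x \<in> X \<Longrightarrow> x z * x z * x z = x z"
  shows "finite {foldr fmul xs (\<lambda>_. 1) | xs. set xs \<subseteq> X}"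
proof -
  interpret Groups.comm_monoid "fmul :: ('x \<Rightarrow> 'f) \<Rightarrow> _" "\<lambda>_. 1"
    by unfold_locales (auto simp: fadd_def fmul_def ac_simps)
  have "finite (range (\<lambda>c. (fmul x ^^ c) (\<lambda>_. 1)))" if "x \<in> X" for x
  proof -
    have "(fmul x ^^ c) (\<lambda>_. 1) \<in> {\<lambda>_. 1, x, \<lambda>z. x z * x z}" for c
      by (induction c) (auto simp: fmul_def assms(2)[OF that] mult.assoc[symmetric])
    then have "range (\<lambda>c. (fmul x ^^ c) (\<lambda>_. 1)) \<subseteq> {\<lambda>_. 1, x, \<lambda>z. x z * x z}" by blast
    then show ?thesis by (rule finite_subset) simp
  qed
  then show ?thesis by (intro finite_generated assms(1))
qed

lemma mat_value_append:
  assumes "\<And>x. \<rho> x \<in> carrier_mat n n"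
  shows "mat_value n \<rho> (v @ w) = mat_value n \<rho> v * mat_value n \<rho> w"
proof (induction v)
  case Nil
  then show ?case using mat_value_carrier[of \<rho> n w, OF assms] by simp
next
  case (Cons x v)
  then show ?case
    using assms[of x] mat_value_carrier[of \<rho> n v, OF assms] mat_value_carrier[of \<rho> n w, OF assms]
    by (simp add: assoc_mult_mat[of _ n n _ n _ n])
qed

text \<open>Entries of products are regarded as functions of the assignment of matrices to the letters,
  so that finiteness below is finiteness modulo the identities.\<close>

definition entry_fun :: "nat \<Rightarrow> nat list \<Rightarrow> nat \<Rightarrow> nat \<Rightarrow> (nat \<Rightarrow> 'f::field mat) \<Rightarrow> 'f" where
  "entry_fun n w i j \<rho> = (if \<forall>x. \<rho> x \<in> carrier (UT_pm n) then mat_value n \<rho> w $$ (i, j) else 0)"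

text \<open>The default \<open>0\<close> satisfies the cube law and the recursion for entries, so
  these hold for every assignment without side condition.\<close>

definition letter_fun :: "nat \<Rightarrow> nat \<Rightarrow> nat \<Rightarrow> nat \<Rightarrow> (nat \<Rightarrow> 'f::field mat) \<Rightarrow> 'f" where
  "letter_fun n y i j \<rho> = (if \<forall>x. \<rho> x \<in> carrier (UT_pm n) then \<rho> y $$ (i, j) else 0)"

lemma letter_fun_cube: "j < n \<Longrightarrow> letter_fun n y j j \<rho> * letter_fun n y j j \<rho> * letter_fun n y j j \<rho> = letter_fun n y j j \<rho>"
proof (cases "\<forall>x. \<rho> x \<in> carrier (UT_pm n)")
  case True
  assume "j < n"
  then have "\<rho> y $$ (j, j) \<in> {0, 1, -1}" using True[THEN spec, of y] by (simp add: UT_pm_def)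
  then show ?thesis using True by (auto simp: letter_fun_def)
next
  case False
  then show ?thesis by (simp only: letter_fun_def if_False) simp
qed

lemma entry_fun_snoc:
  assumes "i < n" "j < n"
  shows "entry_fun n (w @ [y]) i j \<rho> =
    (\<Sum>l<j. entry_fun n w i l \<rho> * letter_fun n y l j \<rho>) + entry_fun n w i j \<rho> * letter_fun n y j j \<rho>"
proof (cases "\<forall>x. \<rho> x \<in> carrier (UT_pm n)")
  case True
  then have \<rho>: "\<rho> x \<in> carrier_mat n n" for x using UT_pm_carrier_mat by blast
  have ut: "\<rho> y $$ (l, j) = 0" if "j < l" "l < n" for l
    using True[THEN spec, of y] that by (auto simp: UT_pm_def upper_triangular_def)
  note c = mat_value_carrier[of \<rho>, OF \<rho>, of w]
  have "mat_value n \<rho> (w @ [y]) $$ (i, j) = (\<Sum>l = 0..<n. mat_value n \<rho> w $$ (i, l) * \<rho> y $$ (l, j))"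
    using \<rho>[of y] c assms by (simp add: mat_value_append[of \<rho>, OF \<rho>] scalar_prod_def)
  also have "\<dots> = (\<Sum>l\<in>{..<Suc j}. mat_value n \<rho> w $$ (i, l) * \<rho> y $$ (l, j))"
    using assms ut by (intro sum.mono_neutral_right) auto
  finally show ?thesis
    using True by (simp add: entry_fun_def letter_fun_def)
next
  case False
  then show ?thesis by (simp only: entry_fun_def letter_fun_def if_False) simp
qed

text \<open>Appending a letter multiplies the entry in column \<open>j\<close> by a diagonal entry
  and adds a term built from columns \<open>l < j\<close>, finitely many by induction. So every
  entry is a sum over a finite set \<open>X\<close> closed under multiplication by diagonal entries,
  and multiplicities matter only modulo \<open>p\<close>.\<close>

lemma finite_entry_funs:
  assumes p: "p > 0" "of_nat p = (0 :: 'f::field)" and ij: "i < n" "j < n"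
  shows "finite {entry_fun n w i j :: (nat \<Rightarrow> 'f mat) \<Rightarrow> 'f | w. set w \<subseteq> {..<k}}"
  using ij(2)
proof (induction j rule: less_induct)
  case (less j)
  let ?E = "\<lambda>j. {entry_fun n w i j :: (nat \<Rightarrow> 'f mat) \<Rightarrow> 'f | w. set w \<subseteq> {..<k}}"
  let ?a = "letter_fun n :: nat \<Rightarrow> nat \<Rightarrow> nat \<Rightarrow> (nat \<Rightarrow> 'f mat) \<Rightarrow> 'f"
  let ?one = "\<lambda>_ :: nat \<Rightarrow> 'f mat. 1 :: 'f" and ?zero = "\<lambda>_ :: nat \<Rightarrow> 'f mat. 0 :: 'f"
  define D where "D = {foldr fmul xs ?one | xs. set xs \<subseteq> (\<lambda>y. ?a y j j) ` {..<k}}"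
  define g where "g f y = (\<lambda>\<rho>. \<Sum>l<j. f l \<rho> * ?a y l j \<rho>)" for f :: "nat \<Rightarrow> (nat \<Rightarrow> 'f mat) \<Rightarrow> 'f" and y
  define G where "G = insert (entry_fun n [] i j) ((\<lambda>(f, y). g f y) ` ((PiE {..<j} ?E) \<times> {..<k}))"
  define X where "X = (\<lambda>(g, d). fmul g d) ` (G \<times> D)"
  have "finite D"
    unfolding D_def using letter_fun_cube[OF less.prems] by (intro finite_fprods) auto
  moreover have "finite (?E l)" if "l < j" for l
    using less.IH[OF that] that less.prems by simp
  then have "finite G"
    unfolding G_def by (intro finite.insertI finite_imageI finite_cartesian_product finite_PiE) auto
  ultimately have X: "finite X" by (simp add: X_def)
  have D1: "?one \<in> D"
    unfolding D_def by (rule CollectI, rule exI[of _ "[]"]) simp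
  have DD: "fmul d (?a y j j) \<in> D" if d: "d \<in> D" "y < k" for d y
  proof -
    obtain xs where "d = foldr fmul xs ?one \<and> set xs \<subseteq> (\<lambda>y. ?a y j j) ` {..<k}"
      using d(1) unfolding D_def mem_Collect_eq by (rule exE)
    then have xs: "d = foldr fmul xs ?one" "set xs \<subseteq> (\<lambda>y. ?a y j j) ` {..<k}" by simp_all
    have "fmul d (?a y j j) = foldr fmul (?a y j j # xs) ?one"
      unfolding xs(1) by (simp add: fmul_def mult.commute)
    moreover have "set (?a y j j # xs) \<subseteq> (\<lambda>y. ?a y j j) ` {..<k}" using xs(2) d(2) by simp
    ultimately show ?thesis unfolding D_def mem_Collect_eq by (intro exI conjI)
  qed
  have GX: "h \<in> X" if "h \<in> G" for h
  proof -
    have "(\<lambda>(g, d). fmul g d) (h, ?one) \<in> X"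
      unfolding X_def using that D1 by (intro imageI) simp
    then show ?thesis by (simp add: fmul_def)
  qed
  have XX: "fmul x (?a y j j) \<in> X" if x: "x \<in> X" "y < k" for x y
  proof -
    obtain h d where hd: "x = fmul h d" "h \<in> G" "d \<in> D" using x(1) unfolding X_def by auto
    have "(\<lambda>(g, d). fmul g d) (h, fmul d (?a y j j)) \<in> X"
      unfolding X_def using hd DD[OF hd(3) x(2)] by (intro imageI) simp
    then show ?thesis unfolding hd(1) by (simp add: fmul_def mult.assoc)
  qed
  have "\<exists>xs. set xs \<subseteq> X \<and> entry_fun n w i j = foldr fadd xs ?zero" if "set w \<subseteq> {..<k}" for w
    using that
  proof (induction w rule: rev_induct)
    case Nil
    have "entry_fun n [] i j \<in> X" by (rule GX) (simp add: G_def)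
    then show ?case by (intro exI[of _ "[entry_fun n [] i j]"]) (simp add: fadd_def)
  next
    case (snoc y w)
    then obtain xs where xs: "set xs \<subseteq> X" "entry_fun n w i j = foldr fadd xs ?zero" by auto
    have y: "y < k" using snoc.prems by simp
    define f where "f = restrict (\<lambda>l. entry_fun n w i l :: (nat \<Rightarrow> 'f mat) \<Rightarrow> 'f) {..<j}"
    have "f \<in> PiE {..<j} ?E" using snoc.prems unfolding f_def by auto
    then have "(\<lambda>(f, y). g f y) (f, y) \<in> G"
      unfolding G_def using y by (intro insertI2 imageI) simp
    then have gX: "g f y \<in> X" using GX by simp
    let ?xs = "map (\<lambda>x. fmul x (?a y j j)) xs"
    have s: "foldr fadd (map (\<lambda>x. fmul x b) xs) ?zero = fmul (foldr fadd xs ?zero) b" for b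
      by (induction xs) (simp_all add: fadd_def fmul_def distrib_right)
    have "entry_fun n (w @ [y]) i j = fadd (g f y) (fmul (entry_fun n w i j) (?a y j j))"
      using entry_fun_snoc[OF ij(1) less.prems, of w y] by (intro ext) (simp add: g_def f_def fadd_def fmul_def)
    also have "\<dots> = foldr fadd (g f y # ?xs) ?zero"
      using s[of "?a y j j"] by (simp add: xs(2))
    finally have "entry_fun n (w @ [y]) i j = foldr fadd (g f y # ?xs) ?zero" .
    moreover have "set (g f y # ?xs) \<subseteq> X" using gX XX[OF _ y] xs(1) by auto
    ultimately show ?case by blast
  qed
  then have "?E j \<subseteq> {foldr fadd xs ?zero | xs. set xs \<subseteq> X}" by blast
  then show ?case
    using finite_fsums[OF X p] by (rule finite_subset)
qed

lemma finite_image_factor: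
  assumes "finite (F ` W)" "\<And>v w. v \<in> W \<Longrightarrow> w \<in> W \<Longrightarrow> F v = F w \<Longrightarrow> G v = G w"
  shows "finite (G ` W)"
proof -
  have "G w \<in> (\<lambda>y. G (SOME v. v \<in> W \<and> F v = y)) ` F ` W" if "w \<in> W" for w
  proof -
    let ?v = "SOME v. v \<in> W \<and> F v = F w"
    have "?v \<in> W \<and> F ?v = F w" by (rule someI[of _ w]) (simp add: that)
    then have "G w = G ?v" using assms(2)[of w ?v] that by simp
    then show ?thesis using that by blast
  qed
  then have "G ` W \<subseteq> (\<lambda>y. G (SOME v. v \<in> W \<and> F v = y)) ` F ` W" by blast
  then show ?thesis using assms(1) by (meson finite_imageI finite_subset)
qed

text \<open>\<open>G\<close> will be evaluation in a finitely generated member of the variety. Words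
  with the same entry functions form an identity of the matrices, so \<open>G\<close> factors
  through a finite set.\<close>

lemma finite_words_mod_identities:
  assumes p: "p > 0" "of_nat p = (0 :: 'f::field)"
    and G: "\<And>v w. v \<noteq> [] \<Longrightarrow> w \<noteq> [] \<Longrightarrow> holds_in (v, w) (UT_pm n :: 'f mat sgrp) \<Longrightarrow> G v = G w"
  shows "finite (G ` {w. w \<noteq> [] \<and> set w \<subseteq> {..<k}})"
proof (rule finite_image_factor)
  let ?W = "{w. w \<noteq> [] \<and> set w \<subseteq> {..<k}}"
  let ?I = "List.product [0..<n] [0..<n]"
  let ?F = "\<lambda>w. map (\<lambda>(i, j). entry_fun n w i j :: (nat \<Rightarrow> 'f mat) \<Rightarrow> 'f) ?I"
  let ?A = "\<Union>i<n. \<Union>j<n. {entry_fun n w i j :: (nat \<Rightarrow> 'f mat) \<Rightarrow> 'f | w. set w \<subseteq> {..<k}}"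
  have "finite ?A" using finite_entry_funs[OF p] by auto
  then have "finite {xs. set xs \<subseteq> ?A \<and> length xs = length ?I}" by (rule finite_lists_length_eq)
  moreover have "?F w \<in> {xs. set xs \<subseteq> ?A \<and> length xs = length ?I}" if "w \<in> ?W" for w
  proof -
    have "entry_fun n w i j \<in> ?A" if "i < n" "j < n" for i j
      using that \<open>w \<in> ?W\<close> by (intro UN_I[of i] UN_I[of j]) auto
    then show ?thesis by (auto simp: set_product)
  qed
  then have "?F ` ?W \<subseteq> {xs. set xs \<subseteq> ?A \<and> length xs = length ?I}" by blast
  ultimately show "finite (?F ` ?W)" by (rule finite_subset[rotated])
  fix v w assume "v \<in> ?W" "w \<in> ?W" and F: "?F v = ?F w"
  then have ne: "v \<noteq> []" "w \<noteq> []" by auto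
  have e: "entry_fun n v i j = (entry_fun n w i j :: (nat \<Rightarrow> 'f mat) \<Rightarrow> 'f)" if "i < n" "j < n" for i j
    using F that by (auto simp: map_eq_conv)
  show "G v = G w"
  proof (rule G[OF ne], unfold holds_in_iff[OF is_semigroup_UT_pm ne], intro allI impI)
    fix \<rho> :: "nat \<Rightarrow> 'f mat" assume \<rho>: "\<forall>x. \<rho> x \<in> carrier (UT_pm n)"
    have c: "mat_value n \<rho> x \<in> carrier_mat n n" for x
      by (rule mat_value_carrier) (use \<rho> UT_pm_carrier_mat in blast)
    have "mat_value n \<rho> v = mat_value n \<rho> w"
    proof (rule eq_matI)
      fix i j assume "i < dim_row (mat_value n \<rho> w)" "j < dim_col (mat_value n \<rho> w)"
      then have "i < n" "j < n" using c[of w] by auto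
      from fun_cong[OF e[OF this], of \<rho>] show "mat_value n \<rho> v $$ (i, j) = mat_value n \<rho> w $$ (i, j)"
        using \<rho> by (simp add: entry_fun_def)
    qed (use c[of v] c[of w] in auto)
    then show "word_value (UT_pm n) \<rho> v = word_value (UT_pm n) \<rho> w"
      using \<rho> by (simp add: word_value_UT_pm ne)
  qed
qed

lemma locally_finite_UT_pm:
  assumes p: "p > 0" "of_nat p = (0 :: 'f::field)"
  shows "locally_finite (generated_variety (UT_pm n :: 'f mat sgrp) :: 'u sgrp set)"
  unfolding locally_finite_def
proof (intro ballI impI)
  fix T :: "'u sgrp" assume T: "T \<in> generated_variety (UT_pm n :: 'f mat sgrp)" and "finitely_generated T"
  then obtain X where X: "finite X" "X \<subseteq> carrier T" "generated_subsemigroup T X = carrier T"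
    by (auto simp: finitely_generated_def)
  have sT: "is_semigroup T"
    and id: "\<And>v w. v \<noteq> [] \<Longrightarrow> w \<noteq> [] \<Longrightarrow> holds_in (v, w) (UT_pm n :: 'f mat sgrp) \<Longrightarrow> holds_in (v, w) T"
    using T by (auto simp: generated_variety_def models_def identities_def free_semigroup_def)
  obtain z where z: "z \<in> carrier T" using sT by (auto simp: is_semigroup_def)
  obtain xs where xs: "set xs = X" using finite_list[OF X(1)] by blast
  define \<rho> where "\<rho> x = (if x < length xs then xs ! x else z)" for x
  have \<rho>: "\<rho> x \<in> carrier T" for x
    using xs X(2) z nth_mem[of x xs] by (auto simp: \<rho>_def)
  let ?W = "{w. w \<noteq> [] \<and> set w \<subseteq> {..<length xs}}"
  have fin: "finite (word_value T \<rho> ` ?W)"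
    using id \<rho> by (intro finite_words_mod_identities[OF p]) (auto simp: holds_in_iff[OF sT])
  have "x \<in> word_value T \<rho> ` ?W" if "x \<in> generated_subsemigroup T X" for x
    using that
  proof induction
    case (gen x)
    then obtain i where "i < length xs" "xs ! i = x" using xs by (auto simp: in_set_conv_nth)
    then show ?case by (intro image_eqI[of _ _ "[i]"]) (auto simp: \<rho>_def)
  next
    case (mult x y)
    then obtain v w where vw: "x = word_value T \<rho> v" "v \<in> ?W" "y = word_value T \<rho> w" "w \<in> ?W" by blast
    then have "x \<cdot>\<^bsub>T\<^esub> y = word_value T \<rho> (v @ w)" using \<rho> by (simp add: word_value_append[OF sT])
    moreover have "v @ w \<in> ?W" using vw by simp
    ultimately show ?case by (rule image_eqI)
  qed
  then have "carrier T \<subseteq> word_value T \<rho> ` ?W"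
    unfolding X(3) by (intro subsetI)
  then show "finite (carrier T)" using fin by (rule finite_subset)
qed

theorem theorem2p19:
  fixes p n :: nat
  assumes "infinite (UNIV :: 'f::field set)"
    and "CHAR('f) = p" and "p > 2"
    and "n \<ge> 4"
    and universe: "infinite (UNIV :: 'u set)"
  shows "inherently_nonfinitely_based TYPE('u) (UT_pm n :: 'f mat sgrp)"
proof -
  have p: "of_nat p = (0 :: 'f)" using of_nat_CHAR assms(2) by metis
  have two: "(2 :: 'f) \<noteq> 0"
  proof
    assume "(2 :: 'f) = 0"
    then have "of_nat 2 = (0 :: 'f)" by simp
    then have "p dvd 2" using assms(2) by (simp only: of_nat_eq_0_iff_char_dvd)
    then show False using assms(3) by (auto dest: dvd_imp_le)
  qed
  let ?V = "generated_variety (UT_pm n :: 'f mat sgrp) :: 'u sgrp set"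
  have "variety ?V"
    unfolding variety_def generated_variety_def
    by (intro exI[of _ "{e \<in> identities. holds_in e (UT_pm n :: 'f mat sgrp)}"] conjI) auto
  moreover have "locally_finite ?V"
    using locally_finite_UT_pm[OF _ p] assms(3) by simp
  moreover have "\<not> (\<exists>W :: 'u sgrp set. finitely_based W \<and> locally_finite W \<and> ?V \<subseteq> W)"
    by (rule no_finitely_based_overvariety[OF is_semigroup_UT_pm universe zimin_isoterm_UT_pm[OF two assms(4)]])
  ultimately show ?thesis
    unfolding inherently_nonfinitely_based_def inherently_nonfinitely_based_variety_def by blast
qed

end
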